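(* Let $d\ge 1$, $\Omega\subset\mathbb{R}^d$ measurable, $0<\beta<1$, $\mathrm{Re},\mathrm{Wi}>0$, $\theta=(1-\beta)/(\mathrm{Re}\,\mathrm{Wi})$, $\mathbf{s}:D(\mathbf{s})\to\mathbb{S}^d$ with $D(\mathbf{s})\subset\mathbb{S}^d_+$, $c_0\ge0$, and $h(\mathbf{C})=-\mathrm{Wi}\cdot\operatorname{Tr}[\mathbf{s}(\mathbf{C})]+c_0$. Suppose there are measurable functions $\{f_i\}_{i\ge0}$ on $\sigma(D(\mathbf{s}))$ and constants $c_{i,p}\ge0$ with $h(\mathbf{C})=\sum_{i,p\ge0}c_{i,p}[\operatorname{Tr}(f_i(\mathbf{C})^2)]^p$ for all $\mathbf{C}\in D(\mathbf{s})$. Let $k$ be the kernel on $\mathcal{F}$ given by $k(\mathbf{q}_1,\mathbf{q}_2)=\frac12\int_\Omega[\mathbf{u}_1\cdot\mathbf{u}_2+\theta\tilde k(\mathbf{c}_1,\mathbf{c}_2)]\,d\mathbf{x}$, $\tilde k(\mathbf{C}_1,\mathbf{C}_2)=\sum_{i,p\ge0}c_{i,p}[\operatorname{Tr}(f_i(\mathbf{C}_1)f_i(\mathbf{C}_2))]^p$, with RKHS $\mathcal{H}$ and feature map $\Phi$. Let $\mathbf{a}_0\in\mathbb{R}^d$ and $\mathbf{A}_{i,p}\in\mathbb{R}^{d^p\times d^p}$ ($i,p\ge0$) satisfy $$A:=\sqrt{2\|\mathbf{a}_0\|_2^2+\frac{2}{\theta}\sum_{i=0}^\infty\sum_{p=0}^\infty\|\mathbf{A}_{i,p}\|_F^2}<\infty,$$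 and define $\psi:\mathbb{R}^d\times D(\mathbf{s})\to\mathbb{R}$ by $$\psi(\mathbf{u},\mathbf{C})=\mathbf{a}_0^T\mathbf{u}+\sum_{i=0}^\infty\sum_{p=0}^\infty\sqrt{c_{i,p}}\operatorname{Tr}\big[\mathbf{A}_{i,p}^Tf_i(\mathbf{C})^{\otimes p}\big].$$ Then there is a unique bounded linear operator $R_\psi:\mathcal{H}\to L^2(\Omega)$ satisfying $R_\psi\Phi(\mathbf{q})=\psi\circ\mathbf{q}$ for every $\mathbf{q}=(\mathbf{u},\mathbf{c})\in\mathcal{F}$, and $\|R_\psi\|\le A$.
   Context: $\mathbb{S}^d$ ($\mathbb{S}^d_+$) are the real symmetric (positive semidefinite) $d\times d$ matrices. For $\mathbf{C}\in\mathbb{S}^d$ with spectrum $\sigma(\mathbf{C})$ and eigenprojections $\mathbf{P}_{\mathbf{C}}(\lambda)$, $f(\mathbf{C}):=\sum_{\lambda\in\sigma(\mathbf{C})}f(\lambda)\mathbf{P}_{\mathbf{C}}(\lambda)$; $\sigma(D(\mathbf{s}))=\bigcup_{\mathbf{C}\in D(\mathbf{s})}\sigma(\mathbf{C})$. $\otimes$ is the Kronecker product, $\mathbf{M}^{\otimes p}$ its $p$-fold power with $\mathbf{M}^{\otimes0}=1$, and $[\,\cdot\,]^0=1$. $\psi\circ\mathbf{q}$ denotes $\mathbf{x}\mapsto\psi(\mathbf{u}(\mathbf{x}),\mathbf{c}(\mathbf{x}))$. A state is a pair $\mathbf{q}=(\mathbf{u},\mathbf{c})$ of measurable fields $\mathbf{u}:\Omega\to\mathbb{R}^d$,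 $\mathbf{c}:\Omega\to D(\mathbf{s})$ with energy $\mathcal{E}(\mathbf{q})=\frac12\int_\Omega[|\mathbf{u}|^2+\theta h(\mathbf{c})]\,d\mathbf{x}$; $\mathcal{F}$ is the set of states with finite energy, identified when equal a.e. The kernel $k$ is positive-definite and $\mathcal{H}$ is its unique reproducing kernel Hilbert space, with feature map $\Phi(\mathbf{q})=k(\cdot,\mathbf{q})$, $\langle\Phi(\mathbf{q}_1),\Phi(\mathbf{q}_2)\rangle_{\mathcal{H}}=k(\mathbf{q}_1,\mathbf{q}_2)$. *)

theory Defs
  imports "HOL-Analysis.Analysis"
begin

definition sym_mat :: "real^'n^'n \<Rightarrow> bool" where
  "sym_mat C \<longleftrightarrow> transpose C = C"

definition psd_mat :: "real^'n^'n \<Rightarrow> bool" where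
  "psd_mat C \<longleftrightarrow> sym_mat C \<and> (\<forall>x. 0 \<le> x \<bullet> (C *v x))"

definition mat_spectrum :: "real^'n^'n \<Rightarrow> real set" where
  "mat_spectrum C = {lam. \<exists>v. v \<noteq> 0 \<and> C *v v = lam *\<^sub>R v}"

definition orth_proj_mat :: "(real^'n) set \<Rightarrow> real^'n^'n" where
  "orth_proj_mat S = (THE P. transpose P = P \<and> P ** P = P \<and> range (\<lambda>x. P *v x) = S)"

definition eigenproj :: "real^'n^'n \<Rightarrow> real \<Rightarrow> real^'n^'n" where
  "eigenproj C lam = orth_proj_mat {v. C *v v = lam *\<^sub>R v}"

definition mat_fun :: "(real \<Rightarrow> real) \<Rightarrow> real^'n^'n \<Rightarrow> real^'n^'n" where
  "mat_fun f C = (\<Sum>lam\<in>mat_spectrum C. f lam *\<^sub>R eigenproj C lam)"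

definition set_spectrum :: "(real^'n^'n) set \<Rightarrow> real set" where
  "set_spectrum D = (\<Union>C\<in>D. mat_spectrum C)"

text \<open>A (d^p x d^p) matrix is represented with rows and columns indexed by multi-indices,
  i.e. lists of length p over the index type 'n (the standard lexicographic identification
  of [d]^p with [d^p] underlying the Kronecker product). Entries at indices that are not
  of length p are irrelevant.\<close>
type_synonym 'n kmat = "'n list \<Rightarrow> 'n list \<Rightarrow> real"

definition multi_idx :: "nat \<Rightarrow> 'n list set" where
  "multi_idx p = {J. length J = p}"

definition kron_pow :: "real^'n^'n \<Rightarrow> nat \<Rightarrow> 'n kmat" where
  "kron_pow M p J K = (if length J = p \<and> length K = p then (\<Prod>l<p. M $ (J ! l) $ (K ! l)) else 0)"

definition tr_AtB :: "nat \<Rightarrow> ('n::finite) kmat \<Rightarrow> 'n kmat \<Rightarrow> real" where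
  "tr_AtB p A B = (\<Sum>J\<in>multi_idx p. \<Sum>K\<in>multi_idx p. A J K * B J K)"

definition frob_sq :: "nat \<Rightarrow> ('n::finite) kmat \<Rightarrow> real" where
  "frob_sq p A = (\<Sum>J\<in>multi_idx p. \<Sum>K\<in>multi_idx p. (A J K)\<^sup>2)"

type_synonym 'n state = "(real^'n \<Rightarrow> real^'n) \<times> (real^'n \<Rightarrow> real^'n^'n)"

text \<open>Finite-energy states (u,c): measurable u : Omega -> R^d, measurable c : Omega -> D(s),
  with E(q) = 1/2 int_Omega |u|^2 + theta h(c) < infinity. (States are not quotiented by a.e.
  equality; all objects below only depend on them through integrals over Omega.)\<close>
definition finite_energy_states ::
  "(real^'n) set \<Rightarrow> (real^'n^'n) set \<Rightarrow> real \<Rightarrow> (real^'n^'n \<Rightarrow> real) \<Rightarrow> 'n state set" where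
  "finite_energy_states \<Omega> D \<theta> h =
     {(u, c). u \<in> borel_measurable (restrict_space lebesgue \<Omega>)
            \<and> c \<in> borel_measurable (restrict_space lebesgue \<Omega>)
            \<and> (\<forall>x\<in>\<Omega>. c x \<in> D)
            \<and> (\<integral>\<^sup>+ x \<in> \<Omega>. ennreal ((1/2) * ((norm (u x))\<^sup>2 + \<theta> * h (c x))) \<partial>lebesgue) < \<infinity>}"

definition kernel_section :: "'s set \<Rightarrow> ('s \<Rightarrow> 's \<Rightarrow> real) \<Rightarrow> 's \<Rightarrow> ('s \<Rightarrow> real)" where
  "kernel_section X k x = (\<lambda>y. if y \<in> X then k y x else 0)"

definition is_rkhs :: "'s set \<Rightarrow> ('s \<Rightarrow> 's \<Rightarrow> real) \<Rightarrow> ('s \<Rightarrow> real) set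
      \<Rightarrow> (('s \<Rightarrow> real) \<Rightarrow> ('s \<Rightarrow> real) \<Rightarrow> real) \<Rightarrow> bool" where
  "is_rkhs X k H ip \<longleftrightarrow>
     (\<forall>g\<in>H. \<forall>y. y \<notin> X \<longrightarrow> g y = 0)
   \<and> (\<lambda>y. 0) \<in> H
   \<and> (\<forall>g\<in>H. \<forall>g'\<in>H. \<forall>a b::real. (\<lambda>y. a * g y + b * g' y) \<in> H)
   \<and> (\<forall>g\<in>H. \<forall>g'\<in>H. ip g g' = ip g' g)
   \<and> (\<forall>g\<in>H. \<forall>g'\<in>H. \<forall>g''\<in>H. \<forall>a b::real.
        ip (\<lambda>y. a * g y + b * g' y) g'' = a * ip g g'' + b * ip g' g'')
   \<and> (\<forall>g\<in>H. 0 \<le> ip g g \<and> (ip g g = 0 \<longrightarrow> g = (\<lambda>y. 0)))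
   \<and> (\<forall>G::nat \<Rightarrow> ('s \<Rightarrow> real). (\<forall>n. G n \<in> H) \<and>
        (\<forall>e>0. \<exists>N. \<forall>m\<ge>N. \<forall>n\<ge>N. sqrt (ip (\<lambda>y. G m y - G n y) (\<lambda>y. G m y - G n y)) < e)
        \<longrightarrow> (\<exists>g\<in>H. (\<lambda>n. sqrt (ip (\<lambda>y. G n y - g y) (\<lambda>y. G n y - g y))) \<longlonglongrightarrow> 0))
   \<and> (\<forall>x\<in>X. kernel_section X k x \<in> H)
   \<and> (\<forall>g\<in>H. \<forall>x\<in>X. ip g (kernel_section X k x) = g x)"

definition rkhs_norm :: "(('s \<Rightarrow> real) \<Rightarrow> ('s \<Rightarrow> real) \<Rightarrow> real) \<Rightarrow> ('s \<Rightarrow> real) \<Rightarrow> real" where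
  "rkhs_norm ip g = sqrt (ip g g)"

definition in_L2 :: "(real^'n) set \<Rightarrow> (real^'n \<Rightarrow> real) \<Rightarrow> bool" where
  "in_L2 \<Omega> f \<longleftrightarrow> f \<in> borel_measurable (restrict_space lebesgue \<Omega>)
                  \<and> set_integrable lebesgue \<Omega> (\<lambda>x. (f x)\<^sup>2)"

definition L2_norm :: "(real^'n) set \<Rightarrow> (real^'n \<Rightarrow> real) \<Rightarrow> real" where
  "L2_norm \<Omega> f = sqrt (LINT x:\<Omega>|lebesgue. (f x)\<^sup>2)"

definition ae_eq_on :: "(real^'n) set \<Rightarrow> (real^'n \<Rightarrow> real) \<Rightarrow> (real^'n \<Rightarrow> real) \<Rightarrow> bool" where
  "ae_eq_on \<Omega> f g \<longleftrightarrow> (AE x in lebesgue. x \<in> \<Omega> \<longrightarrow> f x = g x)"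

text \<open>R is a bounded linear operator from H into L^2(Omega) (values are representatives;
  linearity holds in L^2, i.e. a.e.).\<close>
definition bounded_linear_to_L2 :: "('s \<Rightarrow> real) set \<Rightarrow> (('s \<Rightarrow> real) \<Rightarrow> ('s \<Rightarrow> real) \<Rightarrow> real)
      \<Rightarrow> (real^'n) set \<Rightarrow> (('s \<Rightarrow> real) \<Rightarrow> (real^'n \<Rightarrow> real)) \<Rightarrow> bool" where
  "bounded_linear_to_L2 H ip \<Omega> R \<longleftrightarrow>
     (\<forall>g\<in>H. in_L2 \<Omega> (R g))
   \<and> (\<forall>g\<in>H. \<forall>g'\<in>H. \<forall>a b::real.
        ae_eq_on \<Omega> (R (\<lambda>y. a * g y + b * g' y)) (\<lambda>x. a * R g x + b * R g' x))
   \<and> (\<exists>M. \<forall>g\<in>H. L2_norm \<Omega> (R g) \<le> M * rkhs_norm ip g)"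

definition op_norm_L2 :: "('s \<Rightarrow> real) set \<Rightarrow> (('s \<Rightarrow> real) \<Rightarrow> ('s \<Rightarrow> real) \<Rightarrow> real)
      \<Rightarrow> (real^'n) set \<Rightarrow> (('s \<Rightarrow> real) \<Rightarrow> (real^'n \<Rightarrow> real)) \<Rightarrow> real" where
  "op_norm_L2 H ip \<Omega> R = Inf {M. 0 \<le> M \<and> (\<forall>g\<in>H. L2_norm \<Omega> (R g) \<le> M * rkhs_norm ip g)}"

end

theory Submission
  imports Defs
begin

text \<open>Pointwise, \<open>\<psi>\<close> is the pairing of a fixed vector of squared norm \<open>A\<^sup>2\<close>, built from \<open>a0\<close> and the
  \<open>Am i p\<close>, with the feature vector of \<open>(u, C)\<close> made of \<open>u\<close> and the weighted Kronecker powers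
  \<open>sqrt (c i p) (f i (C))^p\<close>, whose inner products integrate to the kernel \<open>k\<close>. Cauchy-Schwarz
  therefore bounds the \<open>L\<^sup>2\<close> norm of \<open>\<Sum>q. \<alpha> q \<psi>(q)\<close> by \<open>A\<close> times the RKHS norm of
  \<open>\<Sum>q. \<alpha> q \<Phi>(q)\<close>. So \<open>\<Phi>(q) \<mapsto> \<psi>(q)\<close> is well defined and bounded on the span of the kernel sections,
  which is dense, and extends uniquely to \<open>H\<close> because \<open>L\<^sup>2\<close> is complete. Measurability of \<open>\<psi>(q)\<close>
  rests on the spectral theorem: \<open>C \<mapsto> f(C)\<close> is measurable for polynomial \<open>f\<close>, hence for continuous
  and then for Borel \<open>f\<close>.\<close>

section \<open>Spectral theorem for real symmetric matrices\<close>

text \<open>The factors 2 and \<open>2 / \<theta>\<close> in \<open>A\<close> are dual to the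
  weights 1/2 and \<open>\<theta> / 2\<close> with which the kernel counts the velocity and the
  tensor part. Cauchy-Schwarz is applied at each point of \<Omega> and integrated afterwards, so
  \<Omega> may have infinite measure. Two obstacles shape the rest. A function in the span can be
  written as a combination of kernel sections in many ways, and its image is determined only up to
  null sets. The operator is therefore handled as a relation that is closed up inside the product of
  \<open>H\<close> with the square integrable functions; the norm bound makes this relation single
  valued almost everywhere. Moreover, eigenvalues and eigenvectors of the matrix field come without
  a measurable choice. Measurability is instead obtained by enlarging a class of scalar functions
  under pointwise limits, starting from polynomials, for which the functional calculus is plain
  matrix arithmetic.\<close>

lemma symmetric_matrix_inner:
  fixes C :: "real^'n^'n"
  assumes "sym_mat C"
  shows "x \<bullet> (C *v y) = (C *v x) \<bullet> y"
  by (metis assms dot_lmul_matrix sym_mat_def vector_transpose_matrix)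

text \<open>The quadratic is evaluated at its minimum \<open>b / c\<close>; for \<open>c = 0\<close>
  a nonzero \<open>b\<close> would give the value -1 at \<open>(a + 1) / (2 * b)\<close>. This is
  the source of the Cauchy-Schwarz inequalities below for forms that are only semidefinite.\<close>

lemma discriminant_nonpos:
  fixes a b c :: real
  assumes c: "0 \<le> c" and q: "\<And>t. 0 \<le> a - 2 * t * b + t\<^sup>2 * c"
  shows "b\<^sup>2 \<le> a * c"
proof (cases "c = 0")
  case True
  have "b = 0"
  proof (rule ccontr)
    assume "b \<noteq> 0"
    then show False using q[of "(a + 1) / (2 * b)"] True by simp
  qed
  then show ?thesis using True by simp
next
  case False
  then have "0 \<le> (a - 2 * (b / c) * b + (b / c)\<^sup>2 * c) * c"
    using q[of "b / c"] c by (intro mult_nonneg_nonneg) auto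
  also have "\<dots> = a * c - b\<^sup>2"
    using False by (simp add: field_simps power2_eq_square)
  finally show ?thesis by simp
qed

text \<open>First-order condition at a maximum, as the case \<open>a = 0\<close> of the discriminant
  bound. The coefficient \<open>\<bar>c\<bar>\<close> replaces \<open>- c\<close> because the sign
  of \<open>c\<close> is unknown.\<close>

lemma quadratic_linear_coefficient_zero:
  fixes b c :: real
  assumes "\<And>t. 2 * t * b + t\<^sup>2 * c \<le> 0"
  shows "b = 0"
proof -
  have "0 \<le> 0 - 2 * t * b + t\<^sup>2 * \<bar>c\<bar>" for t
    using assms[of t] mult_left_mono[OF abs_ge_minus_self[of c] zero_le_power2[of t]] by simp
  then have "b\<^sup>2 \<le> 0 * \<bar>c\<bar>" by (intro discriminant_nonpos) auto
  then show ?thesis by simp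
qed

text \<open>The eigenvector maximizes the quadratic form on the unit sphere of the subspace: moving
  from the maximizer \<open>v\<close> in direction \<open>C v - l v\<close> would otherwise increase it.\<close>

lemma symmetric_eigenvector_in_subspace:
  fixes C :: "real^'n^'n"
  assumes C: "sym_mat C" and S: "subspace S" and inv: "\<And>x. x \<in> S \<Longrightarrow> C *v x \<in> S"
    and ne: "S \<noteq> {0}"
  obtains v l where "v \<in> S" "norm v = 1" "C *v v = l *\<^sub>R v"
proof -
  obtain w where w: "w \<in> S" "w \<noteq> 0" using ne subspace_0[OF S] by blast
  then have "w /\<^sub>R norm w \<in> S \<inter> sphere 0 1"
    using S by (simp add: subspace_scale)
  then have "S \<inter> sphere 0 1 \<noteq> {}" by blast
  moreover have "compact (S \<inter> sphere 0 1)"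
    by (simp add: S closed_Int_compact closed_subspace)
  moreover have "continuous_on (S \<inter> sphere 0 1) (\<lambda>x. x \<bullet> (C *v x))"
    by (intro continuous_intros)
  ultimately obtain v where v: "v \<in> S" "norm v = 1"
    and max: "\<And>x. x \<in> S \<Longrightarrow> norm x = 1 \<Longrightarrow> x \<bullet> (C *v x) \<le> v \<bullet> (C *v v)"
    using continuous_attains_sup[of "S \<inter> sphere 0 1" "\<lambda>x. x \<bullet> (C *v x)"] by fastforce
  define l where "l = v \<bullet> (C *v v)"
  \<comment> \<open>Homogeneity carries the bound from the unit sphere to all of \<open>S\<close>,
    since perturbations of \<open>v\<close> leave the sphere.\<close>
  have le: "x \<bullet> (C *v x) \<le> l * (x \<bullet> x)" if x: "x \<in> S" for x
  proof (cases "x = 0")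
    case False
    have "(x /\<^sub>R norm x) \<bullet> (C *v (x /\<^sub>R norm x)) \<le> l"
      unfolding l_def by (rule max) (use x False S in \<open>auto simp: subspace_scale\<close>)
    then have "x \<bullet> (C *v x) \<le> l * (norm x * norm x)"
      using False by (simp add: matrix_vector_mult_scaleR field_simps)
    then show ?thesis by (simp add: dot_square_norm power2_eq_square)
  qed auto
  define r where "r = C *v v - l *\<^sub>R v"
  have rS: "r \<in> S" unfolding r_def using v S inv by (simp add: subspace_diff subspace_scale)
  have vv: "v \<bullet> v = 1" using v by (simp add: dot_square_norm)
  have "r \<bullet> r = 0"
  proof (rule quadratic_linear_coefficient_zero)
    fix t :: real
    have "(v + t *\<^sub>R r) \<bullet> (C *v (v + t *\<^sub>R r)) \<le> l * ((v + t *\<^sub>R r) \<bullet> (v + t *\<^sub>R r))"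
      by (rule le) (use v rS S in \<open>auto simp: subspace_add subspace_scale\<close>)
    moreover have "v \<bullet> (C *v r) = r \<bullet> (C *v v)"
      using symmetric_matrix_inner[OF C, of v r] by (simp add: inner_commute)
    moreover have "r \<bullet> r = r \<bullet> (C *v v) - l * (r \<bullet> v)"
      by (subst (2) r_def) (simp add: inner_diff_right)
    moreover define a b q R where "a = r \<bullet> (C *v v)" "b = r \<bullet> v" "q = r \<bullet> (C *v r)" "R = r \<bullet> r"
    ultimately have E: "l + 2 * t * a + t\<^sup>2 * q \<le> l * (1 + 2 * t * b + t\<^sup>2 * R)" and R: "R = a - l * b"
      using vv
      by (simp_all add: matrix_vector_mult_scaleR matrix_vector_right_distrib inner_add_left
          inner_add_right l_def[symmetric] inner_commute[of v r] power2_eq_square distrib_left mult.assoc)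
    \<comment> \<open>By \<open>R = a - l * b\<close> the linear coefficient is
      \<open>r \<bullet> r\<close> itself, and its vanishing is the eigenvector equation.\<close>
    from E have "2 * t * (a - l * b) + t\<^sup>2 * (q - l * R) \<le> 0" by (simp add: algebra_simps)
    then show "2 * t * (r \<bullet> r) + t\<^sup>2 * (r \<bullet> (C *v r) - l * (r \<bullet> r)) \<le> 0"
      unfolding R[symmetric] by (simp add: a_b_q_R_def)
  qed
  then have "C *v v = l *\<^sub>R v" by (simp add: r_def)
  then show thesis using that v by blast
qed

text \<open>By symmetry, the orthogonal complement of an eigenvector inside an invariant subspace is
  invariant again, and it has smaller dimension. Hence the induction runs over invariant subspaces
  of one fixed matrix.\<close>

lemma symmetric_eigenbasis_subspace:
  fixes C :: "real^'n^'n"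
  assumes C: "sym_mat C"
  shows "subspace S \<Longrightarrow> (\<And>x. x \<in> S \<Longrightarrow> C *v x \<in> S) \<Longrightarrow>
    \<exists>B. B \<subseteq> S \<and> finite B \<and> pairwise orthogonal B \<and> (\<forall>b\<in>B. norm b = 1)
      \<and> span B = S \<and> (\<forall>b\<in>B. \<exists>l. C *v b = l *\<^sub>R b)"
proof (induction "dim S" arbitrary: S rule: less_induct)
  case less
  show ?case
  proof (cases "S = {0}")
    case True
    then show ?thesis by (intro exI[of _ "{}"]) auto
  next
    case False
    obtain v l where v: "v \<in> S" "norm v = 1" "C *v v = l *\<^sub>R v"
      using symmetric_eigenvector_in_subspace[OF C less.prems False] by blast
    have vv: "v \<bullet> v = 1" using v by (simp add: dot_square_norm)
    define T where "T = S \<inter> {x. v \<bullet> x = 0}"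
    have T: "subspace T"
      unfolding T_def using less.prems(1) subspace_hyperplane by (rule subspace_inter)
    have "span T \<subset> span S"
    proof -
      have "v \<notin> T" "T \<subseteq> S" using vv by (auto simp: T_def)
      then have "T \<subset> S" using v(1) by blast
      then show ?thesis
        unfolding span_eq_iff[THEN iffD2, OF T] span_eq_iff[THEN iffD2, OF less.prems(1)] .
    qed
    then have "dim T < dim S" by (rule dim_psubset)
    moreover have "C *v x \<in> T" if "x \<in> T" for x
      using that less.prems(2) symmetric_matrix_inner[OF C, of v x] v by (simp add: T_def)
    ultimately obtain B where B: "B \<subseteq> T" "finite B" "pairwise orthogonal B"
      "\<forall>b\<in>B. norm b = 1" "span B = T" "\<forall>b\<in>B. \<exists>l. C *v b = l *\<^sub>R b"
      using less.hyps[OF _ T] by blast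
    have "pairwise orthogonal (insert v B)"
      using B(1,3) by (auto simp: pairwise_insert T_def orthogonal_def inner_commute)
    moreover have "span (insert v B) = S"
    proof
      show "span (insert v B) \<subseteq> S"
        using B(1) v less.prems(1) by (intro span_minimal) (auto simp: T_def)
      show "S \<subseteq> span (insert v B)"
      proof
        fix x assume "x \<in> S"
        then have "x - (v \<bullet> x) *\<^sub>R v \<in> span B"
          using v vv less.prems(1) B(5)
          by (simp add: T_def subspace_diff subspace_scale inner_diff_right)
        then show "x \<in> span (insert v B)"
          by (auto simp: span_breakdown_eq)
      qed
    qed
    ultimately show ?thesis
      using B v by (intro exI[of _ "insert v B"]) (auto simp: T_def)
  qed
qed

lemma symmetric_eigenbasis:
  fixes C :: "real^'n^'n"
  assumes "sym_mat C"
  obtains B l where "finite B" "pairwise orthogonal B" "\<And>b. b \<in> B \<Longrightarrow> norm b = 1"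
    "span B = UNIV" "\<And>b. b \<in> B \<Longrightarrow> C *v b = l b *\<^sub>R b"
proof -
  obtain B where B: "finite B" "pairwise orthogonal B" "\<forall>b\<in>B. norm b = 1"
    "span B = UNIV" "\<forall>b\<in>B. \<exists>l. C *v b = l *\<^sub>R b"
    using symmetric_eigenbasis_subspace[OF assms subspace_UNIV] by auto
  obtain l where "\<forall>b\<in>B. C *v b = l b *\<^sub>R b" using bchoice[OF B(5)] by blast
  then show thesis using that[of B l] B by auto
qed

text \<open>The vector \<open>b\<close> times its transpose; for a unit vector, the orthogonal
  projection onto its line.\<close>

definition outer_square :: "real^'n \<Rightarrow> real^'n^'n" where
  "outer_square b = (\<chi> i j. b $ i * b $ j)"

lemma outer_square_mult [simp]: "outer_square b *v x = (b \<bullet> x) *\<^sub>R b"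
  by (simp add: vec_eq_iff outer_square_def matrix_vector_mult_def inner_vec_def sum_distrib_left
      sum_distrib_right mult_ac)

lemma transpose_outer_square [simp]: "transpose (outer_square b) = outer_square b"
  by (simp add: vec_eq_iff outer_square_def transpose_def mult.commute)

lemma transpose_sum: "transpose (\<Sum>a\<in>T. F a) = (\<Sum>a\<in>T. transpose (F a))"
  by (simp add: vec_eq_iff transpose_def)

lemma transpose_scaleR: "transpose (a *\<^sub>R M) = a *\<^sub>R transpose M"
  for M :: "real^'n^'m"
  by (simp add: vec_eq_iff transpose_def)

lemma sum_scaleR_outer_square_mult:
  "(\<Sum>b\<in>T. a b *\<^sub>R outer_square b) *v x = (\<Sum>b\<in>T. (a b * (b \<bullet> x)) *\<^sub>R b)"
  by (induction T rule: infinite_finite_induct)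
    (auto simp: matrix_vector_mult_add_rdistrib scaleR_matrix_vector_assoc[symmetric])

text \<open>Orthonormality removes the mixed products, so these sums multiply like diagonal
  matrices. Idempotence of the eigenprojections and multiplicativity of the functional calculus both
  rest on this.\<close>

lemma sum_scaleR_outer_square_matrix_mult:
  fixes a a' :: "real^'n \<Rightarrow> real"
  assumes B: "finite B" "pairwise orthogonal B" "\<And>b. b \<in> B \<Longrightarrow> norm b = 1"
  shows "(\<Sum>b\<in>B. a b *\<^sub>R outer_square b) ** (\<Sum>b\<in>B. a' b *\<^sub>R outer_square b)
    = (\<Sum>b\<in>B. (a b * a' b) *\<^sub>R outer_square b)"
proof -
  have "b \<bullet> (\<Sum>b\<in>B. (a' b * (b \<bullet> x)) *\<^sub>R b) = a' b * (b \<bullet> x)" if "b \<in> B" for b and x :: "real^'n"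
  proof -
    have "b \<bullet> (\<Sum>b\<in>B. (a' b * (b \<bullet> x)) *\<^sub>R b) = (\<Sum>d\<in>B. a' d * (d \<bullet> x) * (b \<bullet> d))"
      by (simp add: inner_sum_right)
    also have "\<dots> = (\<Sum>d\<in>B. if d = b then a' b * (b \<bullet> x) else 0)"
      using B(2,3) that
      by (intro sum.cong) (auto simp: pairwise_def orthogonal_def dot_square_norm)
    finally show ?thesis using that B(1) by simp
  qed
  then show ?thesis
    by (simp add: matrix_eq matrix_vector_mul_assoc[symmetric] sum_scaleR_outer_square_mult
        mult.assoc cong: sum.cong)
qed

text \<open>Each projection fixes the range of the other, so \<open>P ** Q = Q\<close> and
  \<open>Q ** P = P\<close>; transposing the first identity gives \<open>Q ** P = Q\<close>. This
  uniqueness resolves the definite description in \<open>orth_proj_mat\<close>.\<close>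

lemma symmetric_idempotent_unique:
  fixes P Q :: "real^'n^'n"
  assumes "transpose P = P" "P ** P = P" "transpose Q = Q" "Q ** Q = Q"
    and r: "range (\<lambda>x. P *v x) = range (\<lambda>x. Q *v x)"
  shows "P = Q"
proof -
  have *: "P ** Q = Q" if idem: "P ** P = P" and r: "range (\<lambda>x. P *v x) = range (\<lambda>x. Q *v x)" for P Q :: "real^'n^'n"
  proof -
    have "P *v (Q *v x) = Q *v x" for x
    proof -
      obtain y where "Q *v x = P *v y" using r by (metis rangeI rangeE)
      then show ?thesis using idem by (simp add: matrix_vector_mul_assoc)
    qed
    then show ?thesis by (simp add: matrix_eq matrix_vector_mul_assoc[symmetric])
  qed
  have "P ** Q = Q" "Q ** P = P" using *[of P Q] *[of Q P] assms by auto
  then show ?thesis using assms by (metis matrix_transpose_mul)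
qed

text \<open>An eigenvector is orthogonal to every basis vector with a different eigenvalue. So each
  eigenspace is spanned by the basis vectors belonging to it, and every eigenvalue occurs among
  theirs.\<close>

lemma eigenproj_eq:
  fixes C :: "real^'n^'n"
  assumes B: "finite B" "pairwise orthogonal B" "\<And>b. b \<in> B \<Longrightarrow> norm b = 1"
    "span B = UNIV" and l: "\<And>b. b \<in> B \<Longrightarrow> C *v b = l b *\<^sub>R b" and C: "sym_mat C"
  shows "eigenproj C lam = (\<Sum>b\<in>{b\<in>B. l b = lam}. outer_square b)"
    and "mat_spectrum C = l ` B"
proof -
  have expand: "(\<Sum>b\<in>B. (b \<bullet> x) *\<^sub>R b) = x" for x
    using orthonormal_basis_expand[of B x] B by (simp add: inner_commute)
  have orth: "b \<bullet> v = 0" if "b \<in> B" "C *v v = m *\<^sub>R v" "l b \<noteq> m" for b v m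
  proof -
    have "m * (b \<bullet> v) = l b * (b \<bullet> v)"
      using symmetric_matrix_inner[OF C, of b v] l[OF that(1)] that(2) by simp
    then show ?thesis using that(3) by simp
  qed
  \<comment> \<open>Weights 0 and 1 over the whole basis, instead of a smaller index set, let the
    product rule for diagonal sums give idempotence.\<close>
  let ?P = "\<Sum>b\<in>B. (if l b = lam then 1 else 0) *\<^sub>R outer_square b"
  have P: "transpose ?P = ?P" "?P ** ?P = ?P"
    by (simp_all add: transpose_sum transpose_scaleR sum_scaleR_outer_square_matrix_mult B)
      (auto intro!: sum.cong)
  have "range (\<lambda>x. ?P *v x) = {v. C *v v = lam *\<^sub>R v}"
  proof (intro set_eqI iffI)
    fix v assume "v \<in> range (\<lambda>x. ?P *v x)"
    then obtain x where v: "v = (\<Sum>b\<in>B. ((if l b = lam then 1 else 0) * (b \<bullet> x)) *\<^sub>R b)"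
      by (auto simp: sum_scaleR_outer_square_mult)
    have "C *v v = (\<Sum>b\<in>B. ((if l b = lam then 1 else 0) * (b \<bullet> x)) *\<^sub>R (C *v b))"
      unfolding v by (simp add: linear_sum[OF matrix_vector_mul_linear[of C]] matrix_vector_mult_scaleR)
    also have "\<dots> = lam *\<^sub>R v"
      unfolding v scaleR_right.sum by (intro sum.cong) (auto simp: l)
    finally show "v \<in> {v. C *v v = lam *\<^sub>R v}" by simp
  next
    fix v assume "v \<in> {v. C *v v = lam *\<^sub>R v}"
    then have "?P *v v = (\<Sum>b\<in>B. (b \<bullet> v) *\<^sub>R b)"
      unfolding sum_scaleR_outer_square_mult by (intro sum.cong) (auto dest: orth)
    then have "v = ?P *v v" by (simp only: expand)
    then show "v \<in> range (\<lambda>x. ?P *v x)" by (rule range_eqI)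
  qed
  with P have "orth_proj_mat {v. C *v v = lam *\<^sub>R v} = ?P"
    unfolding orth_proj_mat_def
    by (intro the_equality) (auto intro!: symmetric_idempotent_unique)
  also have "?P = (\<Sum>b\<in>{b\<in>B. l b = lam}. outer_square b)"
    using B(1) by (simp add: sum.inter_filter if_distrib[of "\<lambda>a. a *\<^sub>R _"] cong: if_cong)
  finally show "eigenproj C lam = (\<Sum>b\<in>{b\<in>B. l b = lam}. outer_square b)"
    by (simp add: eigenproj_def)
  show "mat_spectrum C = l ` B"
  proof (intro set_eqI iffI)
    fix m assume "m \<in> mat_spectrum C"
    then obtain v where v: "v \<noteq> 0" "C *v v = m *\<^sub>R v" by (auto simp: mat_spectrum_def)
    have "\<exists>b\<in>B. b \<bullet> v \<noteq> 0"
    proof (rule ccontr)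
      assume "\<not> (\<exists>b\<in>B. b \<bullet> v \<noteq> 0)"
      then have "(\<Sum>b\<in>B. (b \<bullet> v) *\<^sub>R b) = 0" by (intro sum.neutral) auto
      then show False using expand[of v] v(1) by simp
    qed
    then show "m \<in> l ` B" using orth v by blast
  next
    fix m assume "m \<in> l ` B"
    then obtain b where b: "b \<in> B" "m = l b" by blast
    then have "b \<noteq> 0" using B(3) by force
    then show "m \<in> mat_spectrum C" using l b by (auto simp: mat_spectrum_def)
  qed
qed

text \<open>Grouping the basis vectors by eigenvalue turns the sum over the spectrum into a sum over
  one basis that serves all \<open>g\<close> at once, so algebraic identities for
  \<open>mat_fun\<close> can be checked on coefficients.\<close>

lemma spectral_decomposition:
  fixes C :: "real^'n^'n"
  assumes "sym_mat C"
  obtains B l where "finite B" "pairwise orthogonal B" "\<And>b. b \<in> B \<Longrightarrow> norm b = 1"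
    "\<And>g. mat_fun g C = (\<Sum>b\<in>B. g (l b) *\<^sub>R outer_square b)"
    "mat_fun (\<lambda>t. t) C = C" "mat_fun (\<lambda>t. 1) C = mat 1"
proof -
  obtain B l where B: "finite B" "pairwise orthogonal B" "\<And>b. b \<in> B \<Longrightarrow> norm b = 1"
    "span B = UNIV" and l: "\<And>b. b \<in> B \<Longrightarrow> C *v b = l b *\<^sub>R b"
    using symmetric_eigenbasis[OF assms] by metis
  note eig = eigenproj_eq[OF B l assms]
  have f: "mat_fun g C = (\<Sum>b\<in>B. g (l b) *\<^sub>R outer_square b)" for g
  proof -
    have "mat_fun g C = (\<Sum>m\<in>l ` B. g m *\<^sub>R (\<Sum>b\<in>{b\<in>B. l b = m}. outer_square b))"
      by (simp only: mat_fun_def eig)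
    also have "\<dots> = (\<Sum>m\<in>l ` B. \<Sum>b\<in>{b\<in>B. l b = m}. g (l b) *\<^sub>R outer_square b)"
      by (intro sum.cong refl) (simp add: scaleR_right.sum)
    also have "\<dots> = (\<Sum>b\<in>B. g (l b) *\<^sub>R outer_square b)"
      using B(1) by (rule sum.image_gen[symmetric])
    finally show ?thesis .
  qed
  have expand: "(\<Sum>b\<in>B. (b \<bullet> x) *\<^sub>R b) = x" for x
    using orthonormal_basis_expand[of B x] B by (simp add: inner_commute)
  have "(\<Sum>b\<in>B. (l b * (b \<bullet> x)) *\<^sub>R b) = C *v x" for x
  proof -
    have "C *v x = C *v (\<Sum>b\<in>B. (b \<bullet> x) *\<^sub>R b)" by (simp only: expand)
    also have "\<dots> = (\<Sum>b\<in>B. (b \<bullet> x) *\<^sub>R (l b *\<^sub>R b))"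
      by (simp add: linear_sum[OF matrix_vector_mul_linear[of C]] matrix_vector_mult_scaleR l)
    finally show ?thesis by (simp add: mult.commute)
  qed
  then have "mat_fun (\<lambda>t. t) C = C" by (simp add: matrix_eq f sum_scaleR_outer_square_mult)
  moreover have "mat_fun (\<lambda>t. 1) C = mat 1"
    unfolding matrix_eq f sum_scaleR_outer_square_mult by (simp add: expand)
  ultimately show thesis
    using that[of B l] B(1-3) f by blast
qed

section \<open>Measurability of the functional calculus\<close>

lemma mat_fun_cong:
  "(\<And>t. t \<in> mat_spectrum C \<Longrightarrow> g t = g' t) \<Longrightarrow> mat_fun g C = mat_fun g' C"
  by (simp add: mat_fun_def)

lemma mat_fun_add: "mat_fun (\<lambda>t. g t + g' t) C = mat_fun g C + mat_fun g' C"
  by (simp add: mat_fun_def scaleR_add_left sum.distrib)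

lemma mat_fun_cmult: "mat_fun (\<lambda>t. a * g t) C = a *\<^sub>R mat_fun g C"
  by (simp add: mat_fun_def scaleR_right.sum)

lemma mat_fun_tendsto:
  assumes "\<And>t. t \<in> mat_spectrum C \<Longrightarrow> (\<lambda>n. G n t) \<longlonglongrightarrow> g t"
  shows "(\<lambda>n. mat_fun (G n) C) \<longlonglongrightarrow> mat_fun g C"
  unfolding mat_fun_def by (intro tendsto_sum tendsto_scaleR assms tendsto_const)

lemma mat_fun_id: "sym_mat C \<Longrightarrow> mat_fun (\<lambda>t. t) C = C"
  by (rule spectral_decomposition)

lemma mat_fun_one: "sym_mat C \<Longrightarrow> mat_fun (\<lambda>t. 1) C = mat 1"
  by (rule spectral_decomposition)

lemma mat_fun_mult:
  assumes "sym_mat C"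
  shows "mat_fun (\<lambda>t. g t * g' t) C = mat_fun g C ** mat_fun g' C"
proof (rule spectral_decomposition[OF assms])
  fix B l
  assume B: "finite B" "pairwise orthogonal B" "\<And>b. b \<in> B \<Longrightarrow> norm b = 1"
    and f: "\<And>g. mat_fun g C = (\<Sum>b\<in>B. g (l b) *\<^sub>R outer_square b)"
  show ?thesis unfolding f by (simp add: sum_scaleR_outer_square_matrix_mult B)
qed

lemma transpose_mat_fun:
  assumes "sym_mat C"
  shows "transpose (mat_fun g C) = mat_fun g C"
proof (rule spectral_decomposition[OF assms])
  fix B l
  assume f: "\<And>g. mat_fun g C = (\<Sum>b\<in>B. g (l b) *\<^sub>R outer_square b)"
  show ?thesis unfolding f by (simp add: transpose_sum transpose_scaleR)
qed

lemma borel_measurable_matrix_iff: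
  fixes F :: "'a \<Rightarrow> real^'n^'m"
  shows "F \<in> borel_measurable N \<longleftrightarrow> (\<forall>i j. (\<lambda>x. F x $ i $ j) \<in> borel_measurable N)"
  by (subst borel_measurable_euclidean_space)
    (auto simp: Basis_vec_def inner_axis)

lemma borel_measurable_matrix_mult:
  fixes F G :: "'a \<Rightarrow> real^'n^'n"
  assumes "F \<in> borel_measurable N" "G \<in> borel_measurable N"
  shows "(\<lambda>x. F x ** G x) \<in> borel_measurable N"
  using assms unfolding borel_measurable_matrix_iff matrix_matrix_mult_def
  by (auto intro!: borel_measurable_sum borel_measurable_times)

context
  fixes N :: "'a measure" and c :: "'a \<Rightarrow> real^'n^'n" and D :: "(real^'n^'n) set"
  assumes c: "c \<in> borel_measurable N" and cD: "\<And>x. x \<in> space N \<Longrightarrow> c x \<in> D"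
    and D: "\<And>C. C \<in> D \<Longrightarrow> sym_mat C"
begin

text \<open>For polynomials the functional calculus is addition and multiplication of matrices
  applied to \<open>c x\<close>, so measurability is a matter of entries.\<close>

lemma mat_fun_measurable_polynomial:
  assumes "real_polynomial_function g"
  shows "(\<lambda>x. mat_fun g (c x)) \<in> borel_measurable N"
  using assms
proof (induction rule: real_polynomial_function.induct)
  case (linear g)
  then obtain a where g: "g = (\<lambda>t. t * a)" using real_bounded_linear by blast
  have "(\<lambda>x. mat_fun (\<lambda>t. a * t) (c x)) \<in> borel_measurable N
    \<longleftrightarrow> (\<lambda>x. a *\<^sub>R c x) \<in> borel_measurable N"
    by (intro measurable_cong) (simp add: mat_fun_cmult mat_fun_id D cD)
  then show ?case using c by (simp add: g mult.commute)
next
  case (const a)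
  have "(\<lambda>x. mat_fun (\<lambda>t. a * 1) (c x)) \<in> borel_measurable N
    \<longleftrightarrow> (\<lambda>x. a *\<^sub>R mat 1 :: real^'n^'n) \<in> borel_measurable N"
    by (intro measurable_cong) (simp only: mat_fun_cmult mat_fun_one D cD)
  then show ?case by simp
next
  case (add g g')
  then show ?case by (simp add: mat_fun_add)
next
  case (mult g g')
  have "(\<lambda>x. mat_fun (\<lambda>t. g t * g' t) (c x)) \<in> borel_measurable N
    \<longleftrightarrow> (\<lambda>x. mat_fun g (c x) ** mat_fun g' (c x)) \<in> borel_measurable N"
    by (intro measurable_cong) (simp add: mat_fun_mult D cD)
  then show ?case using borel_measurable_matrix_mult mult.IH by blast
qed

lemma mat_fun_measurable_const: "(\<lambda>x. mat_fun (\<lambda>t. a) (c x)) \<in> borel_measurable N"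
  by (rule mat_fun_measurable_polynomial) (rule real_polynomial_function.intros)

text \<open>Convergence is asked for on the spectra occurring in \<open>D\<close> only. Each later
  enlargement of the class of functions passes through this limit.\<close>

lemma mat_fun_measurable_limit:
  assumes "\<And>n. (\<lambda>x. mat_fun (G n) (c x)) \<in> borel_measurable N"
    and "\<And>t. t \<in> set_spectrum D \<Longrightarrow> (\<lambda>n. G n t) \<longlonglongrightarrow> g t"
  shows "(\<lambda>x. mat_fun g (c x)) \<in> borel_measurable N"
proof (rule borel_measurable_LIMSEQ_metric[OF assms(1)])
  fix x assume "x \<in> space N"
  then show "(\<lambda>n. mat_fun (G n) (c x)) \<longlonglongrightarrow> mat_fun g (c x)"
    using assms(2) cD by (intro mat_fun_tendsto) (auto simp: set_spectrum_def)
qed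

text \<open>The spectra in \<open>D\<close> may be unbounded, so the Weierstrass approximations are
  taken on growing intervals. They converge pointwise because each \<open>t\<close> lies in all but
  finitely many of these intervals.\<close>

lemma mat_fun_measurable_continuous:
  assumes "continuous_on UNIV g"
  shows "(\<lambda>x. mat_fun g (c x)) \<in> borel_measurable N"
proof -
  have "\<exists>p. real_polynomial_function p \<and> (\<forall>t\<in>{- real n..real n}. \<bar>g t - p t\<bar> < 1 / real (Suc n))" for n
    using Stone_Weierstrass_polynomial_function[of "{- real n..real n}" g "1 / real (Suc n)"]
      continuous_on_subset[OF assms] by (auto simp: real_polynomial_function_eq)
  then obtain p where p: "\<And>n. real_polynomial_function (p n)"
    and close: "\<And>n t. t \<in> {- real n..real n} \<Longrightarrow> \<bar>g t - p n t\<bar> < 1 / real (Suc n)"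
    by metis
  have "(\<lambda>n. p n t) \<longlonglongrightarrow> g t" for t
  proof -
    have "eventually (\<lambda>n. norm (p n t - g t) \<le> 1 / real (Suc n)) sequentially"
      using eventually_ge_at_top[of "nat \<lceil>\<bar>t\<bar>\<rceil>"]
    proof eventually_elim
      case (elim n)
      then have "\<bar>t\<bar> \<le> real n" by linarith
      then show ?case using close[of t n] by (simp add: abs_le_iff abs_less_iff)
    qed
    then have "(\<lambda>n. p n t - g t) \<longlonglongrightarrow> 0"
      by (rule Lim_null_comparison) (rule LIMSEQ_Suc[OF lim_1_over_n])
    then show ?thesis by (simp add: LIM_zero_iff)
  qed
  then show ?thesis
    using mat_fun_measurable_limit[of p g] mat_fun_measurable_polynomial[OF p] by blast
qed

text \<open>The half-lines \<open>{..a}\<close> generate the Borel sets and are stable under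
  intersection, so it suffices to treat them and to pass to complements and countable disjoint
  unions.\<close>

lemma mat_fun_measurable_indicator:
  assumes "A \<in> sets borel"
  shows "(\<lambda>x. mat_fun (indicator A) (c x)) \<in> borel_measurable N"
proof -
  let ?G = "range (\<lambda>a::real. {..a})"
  have "Int_stable ?G" by (auto simp: Int_stable_def)
  moreover have "?G \<subseteq> Pow UNIV" by simp
  moreover have "A \<in> sigma_sets UNIV ?G"
    using assms by (simp add: borel_eq_atMost)
  ultimately show ?thesis
  proof (induction rule: sigma_sets_induct_disjoint)
    case (basic A)
    then obtain a where A: "A = {..a}" by auto
    \<comment> \<open>Continuous functions that equal 1 on the half-line and decay to 0 beyond
      it.\<close>
    have "(\<lambda>n. exp (- real n * max 0 (t - a))) \<longlonglongrightarrow> indicator A t" for t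
    proof (cases "t \<le> a")
      case False
      have "(\<lambda>n. exp (- (t - a)) ^ n) \<longlonglongrightarrow> 0"
        using False by (intro LIMSEQ_power_zero) simp
      then show ?thesis using False by (simp add: A exp_of_nat_mult[symmetric] algebra_simps)
    qed (simp add: A)
    moreover have "(\<lambda>x. mat_fun (\<lambda>t. exp (- real n * max 0 (t - a))) (c x)) \<in> borel_measurable N" for n
      by (intro mat_fun_measurable_continuous continuous_intros)
    ultimately show ?case
      using mat_fun_measurable_limit[of "\<lambda>n t. exp (- real n * max 0 (t - a))" "indicator A"] by blast
  next
    case empty
    then show ?case using mat_fun_measurable_const[of 0]
      by (simp add: indicator_def)
  next
    case (compl A)
    have "(\<lambda>x. mat_fun (\<lambda>t. 1 + (-1) * indicator A t) (c x)) \<in> borel_measurable N"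
      unfolding mat_fun_add mat_fun_cmult
      using compl mat_fun_measurable_const[of 1] by simp
    moreover have "(\<lambda>t. 1 + (-1) * indicator A t) = (indicator (UNIV - A) :: real \<Rightarrow> real)"
      by (auto simp: indicator_def)
    ultimately show ?case by simp
  next
    case (union A)
    have "(\<lambda>x. mat_fun (\<lambda>t. \<Sum>i<n. indicator (A i) t) (c x)) \<in> borel_measurable N" for n
      by (induction n)
        (use union mat_fun_measurable_const[of 0]
          in \<open>simp_all add: mat_fun_add\<close>)
    moreover have "(\<lambda>n. \<Sum>i<n. indicator (A i) t) \<longlonglongrightarrow> (indicator (\<Union>i. A i) t :: real)" for t
      using indicator_sums[of A t] union(1) unfolding sums_def disjoint_family_on_def by simp
    ultimately show ?case
      by (rule mat_fun_measurable_limit)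
  qed
qed

text \<open>The function \<open>g\<close> is measurable only relative to
  \<open>set_spectrum D\<close>, which need not be a Borel set. A relatively measurable set is the
  trace of a Borel set, and \<open>mat_fun\<close> sees only values on the spectrum, so indicators
  reduce to the Borel case.\<close>

lemma mat_fun_measurable:
  assumes g: "g \<in> borel_measurable (restrict_space borel (set_spectrum D))"
  shows "(\<lambda>x. mat_fun g (c x)) \<in> borel_measurable N"
proof -
  have nonneg: "(\<lambda>x. mat_fun u (c x)) \<in> borel_measurable N"
    if "u \<in> borel_measurable (restrict_space borel (set_spectrum D))" "\<And>t. 0 \<le> u t" for u
    using that
  proof (induction rule: borel_measurable_induct_real)
    case (set A)
    then obtain B where B: "B \<in> sets borel" "A = set_spectrum D \<inter> B"
      by (auto simp: sets_restrict_space)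
    have "(\<lambda>x. mat_fun (indicator A) (c x)) \<in> borel_measurable N
      \<longleftrightarrow> (\<lambda>x. mat_fun (indicator B) (c x)) \<in> borel_measurable N"
      by (intro measurable_cong mat_fun_cong)
        (use cD B(2) in \<open>auto simp: set_spectrum_def indicator_def\<close>)
    then show ?case using mat_fun_measurable_indicator[OF B(1)] by simp
  next
    case (mult u a)
    then show ?case by (simp add: mat_fun_cmult)
  next
    case (add u v)
    then show ?case by (simp add: mat_fun_add)
  next
    case (seq U)
    show ?case
    proof (rule mat_fun_measurable_limit)
      show "(\<lambda>x. mat_fun (U n) (c x)) \<in> borel_measurable N" for n by (rule seq.IH)
      show "(\<lambda>n. U n t) \<longlonglongrightarrow> u t" if "t \<in> set_spectrum D" for t
        using that by (intro seq.hyps) (simp add: space_restrict_space)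
    qed
  qed
  \<comment> \<open>The induction covers nonnegative functions. The difference of the two parts is
    written with a factor -1 to match \<open>mat_fun_add\<close> and
    \<open>mat_fun_cmult\<close>.\<close>
  have "(\<lambda>x. mat_fun (\<lambda>t. max 0 (g t) + (-1) * max 0 (- g t)) (c x)) \<in> borel_measurable N"
    unfolding mat_fun_add mat_fun_cmult
    by (intro borel_measurable_add borel_measurable_scaleR borel_measurable_const nonneg
        borel_measurable_max borel_measurable_uminus g) auto
  moreover have "(\<lambda>t. max 0 (g t) + (-1) * max 0 (- g t)) = g" by (auto simp: max_def)
  ultimately show ?thesis by simp
qed

end

section \<open>Reproducing kernels and square integrable functions\<close>

text \<open>One framework for \<open>H\<close> and for the square integrable functions. Linear
  combinations are spelled out because \<open>H\<close> is a set of functions, and the form is only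
  semidefinite because functions equal almost everywhere are not identified.\<close>

locale semi_inner_function_space =
  fixes H :: "('s \<Rightarrow> real) set" and ip :: "('s \<Rightarrow> real) \<Rightarrow> ('s \<Rightarrow> real) \<Rightarrow> real"
  assumes comb_closed: "\<And>g g' a b. g \<in> H \<Longrightarrow> g' \<in> H \<Longrightarrow> (\<lambda>y. a * g y + b * g' y) \<in> H"
    and ip_commute: "\<And>g g'. g \<in> H \<Longrightarrow> g' \<in> H \<Longrightarrow> ip g g' = ip g' g"
    and ip_comb_left: "\<And>g g' g'' a b. g \<in> H \<Longrightarrow> g' \<in> H \<Longrightarrow> g'' \<in> H \<Longrightarrow>
      ip (\<lambda>y. a * g y + b * g' y) g'' = a * ip g g'' + b * ip g' g''"
    and ip_nonneg: "\<And>g. g \<in> H \<Longrightarrow> 0 \<le> ip g g"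
begin

definition seminorm :: "('s \<Rightarrow> real) \<Rightarrow> real" where
  "seminorm g = sqrt (ip g g)"

lemma seminorm_nonneg: "g \<in> H \<Longrightarrow> 0 \<le> seminorm g"
  by (simp add: seminorm_def ip_nonneg)

lemma seminorm_power2: "g \<in> H \<Longrightarrow> (seminorm g)\<^sup>2 = ip g g"
  by (simp add: seminorm_def ip_nonneg)

lemma diff_closed: "g \<in> H \<Longrightarrow> g' \<in> H \<Longrightarrow> (\<lambda>y. g y - g' y) \<in> H"
  using comb_closed[of g g' 1 "-1"] by simp

lemma ip_comb_self:
  assumes "g \<in> H" "g' \<in> H"
  shows "ip (\<lambda>y. a * g y + b * g' y) (\<lambda>y. a * g y + b * g' y)
    = a\<^sup>2 * ip g g + 2 * a * b * ip g g' + b\<^sup>2 * ip g' g'"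
proof -
  let ?c = "\<lambda>y. a * g y + b * g' y"
  have c: "?c \<in> H" using assms by (rule comb_closed)
  have right: "ip u ?c = a * ip g u + b * ip g' u" if "u \<in> H" for u
    unfolding ip_commute[OF that c] by (rule ip_comb_left[OF assms that])
  have "ip ?c ?c = a * ip g ?c + b * ip g' ?c" by (rule ip_comb_left[OF assms c])
  also have "\<dots> = a * (a * ip g g + b * ip g' g) + b * (a * ip g g' + b * ip g' g')"
    by (simp only: right assms)
  finally show ?thesis
    by (simp add: ip_commute[OF assms(2,1)] power2_eq_square algebra_simps)
qed

lemma ip_diff_self:
  assumes "g \<in> H" "g' \<in> H"
  shows "ip (\<lambda>y. g y - g' y) (\<lambda>y. g y - g' y) = ip g g - 2 * ip g g' + ip g' g'"
  using ip_comb_self[OF assms, of 1 "-1"] by simp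

lemma seminorm_diff_self: "g \<in> H \<Longrightarrow> seminorm (\<lambda>y. g y - g y) = 0"
  by (simp only: seminorm_def ip_diff_self) simp

lemma Cauchy_Schwarz_ip:
  assumes "g \<in> H" "g' \<in> H"
  shows "(ip g g')\<^sup>2 \<le> ip g g * ip g' g'"
proof (rule discriminant_nonpos)
  show "0 \<le> ip g g - 2 * t * ip g g' + t\<^sup>2 * ip g' g'" for t
    using ip_nonneg[OF comb_closed[OF assms, of 1 "- t"]] ip_comb_self[OF assms, of 1 "- t"] by simp
qed (use assms ip_nonneg in auto)

lemma seminorm_comb_le:
  assumes "g \<in> H" "g' \<in> H"
  shows "seminorm (\<lambda>y. a * g y + b * g' y) \<le> \<bar>a\<bar> * seminorm g + \<bar>b\<bar> * seminorm g'"
proof -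
  have "sqrt ((ip g g')\<^sup>2) \<le> sqrt (ip g g * ip g' g')"
    using Cauchy_Schwarz_ip[OF assms] by (rule real_sqrt_le_mono)
  then have "\<bar>ip g g'\<bar> \<le> seminorm g * seminorm g'"
    by (simp add: seminorm_def real_sqrt_mult)
  then have "\<bar>a * b\<bar> * \<bar>ip g g'\<bar> \<le> \<bar>a * b\<bar> * (seminorm g * seminorm g')"
    by (intro mult_left_mono) auto
  then have "a * b * ip g g' \<le> \<bar>a * b\<bar> * (seminorm g * seminorm g')"
    using abs_ge_self[of "a * b * ip g g'"] by (simp only: abs_mult)
  then have "ip (\<lambda>y. a * g y + b * g' y) (\<lambda>y. a * g y + b * g' y)
      \<le> (\<bar>a\<bar> * seminorm g + \<bar>b\<bar> * seminorm g')\<^sup>2"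
    unfolding ip_comb_self[OF assms]
    by (simp add: power2_sum power_mult_distrib seminorm_power2 assms abs_mult mult_ac)
  then show ?thesis
    unfolding seminorm_def[of "\<lambda>y. a * g y + b * g' y"]
    by (rule real_le_lsqrt[rotated]) (simp add: assms seminorm_nonneg)
qed

lemma seminorm_diff_le:
  "g \<in> H \<Longrightarrow> g' \<in> H \<Longrightarrow> seminorm (\<lambda>y. g y - g' y) \<le> seminorm g + seminorm g'"
  using seminorm_comb_le[of g g' 1 "-1"] by simp

lemma seminorm_diff_commute:
  "g \<in> H \<Longrightarrow> g' \<in> H \<Longrightarrow> seminorm (\<lambda>y. g y - g' y) = seminorm (\<lambda>y. g' y - g y)"
  by (simp add: seminorm_def ip_diff_self ip_commute)

lemma seminorm_triangle:
  assumes "g \<in> H" "g' \<in> H" "g'' \<in> H"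
  shows "seminorm (\<lambda>y. g y - g'' y) \<le> seminorm (\<lambda>y. g y - g' y) + seminorm (\<lambda>y. g' y - g'' y)"
  using seminorm_comb_le[of "\<lambda>y. g y - g' y" "\<lambda>y. g' y - g'' y" 1 1] assms
  by (simp add: diff_closed)

end

lemma is_rkhs_semi_inner:
  assumes "is_rkhs X k H ip"
  shows "semi_inner_function_space H ip"
  by unfold_locales (use assms in \<open>auto simp: is_rkhs_def\<close>)

text \<open>The error \<open>E n\<close> of a minimizing sequence of approximations to \<open>g\<close> is Cauchy and asymptotically
  orthogonal to the kernel sections, so its limit vanishes pointwise by the reproducing property.\<close>

lemma rkhs_kernel_sections_dense:
  assumes rkhs: "is_rkhs X k H ip"
    and S: "S \<subseteq> H" "\<And>s s' a b. s \<in> S \<Longrightarrow> s' \<in> S \<Longrightarrow> (\<lambda>y. a * s y + b * s' y) \<in> S"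
    and K: "\<And>x. x \<in> X \<Longrightarrow> kernel_section X k x \<in> S" and ne: "S \<noteq> {}"
    and g: "g \<in> H" and e: "0 < e"
  shows "\<exists>s\<in>S. ip (\<lambda>y. g y - s y) (\<lambda>y. g y - s y) < e"
proof -
  interpret semi_inner_function_space H ip using rkhs by (rule is_rkhs_semi_inner)
  define Q where "Q s = ip (\<lambda>y. g y - s y) (\<lambda>y. g y - s y)" for s
  define d where "d = Inf (Q ` S)"
  have d_le: "d \<le> Q s" if "s \<in> S" for s
    unfolding d_def using that S(1) g
    by (intro cInf_lower bdd_belowI2[of _ 0]) (auto simp: Q_def intro!: ip_nonneg diff_closed)
  have "\<exists>s\<in>S. Q s < d + 1 / real (Suc n)" for n
    using cInf_lessD[of "Q ` S" "d + 1 / real (Suc n)"] ne unfolding d_def by auto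
  then obtain s where sS: "\<And>n. s n \<in> S" and s_lt: "\<And>n. Q (s n) < d + 1 / real (Suc n)" by metis
  define E where "E n = (\<lambda>y. g y - s n y)" for n
  have sH: "s n \<in> H" for n using sS S(1) by blast
  have EH: "E n \<in> H" for n unfolding E_def using g sH by (rule diff_closed)
  have E_lt: "ip (E n) (E n) < d + 1 / real (Suc n)" for n
    using s_lt[of n] by (simp add: Q_def E_def)
  \<comment> \<open>Since \<open>s n + r t\<close> stays in \<open>S\<close>, no \<open>r\<close>
    brings the squared error below the infimum \<open>d\<close>, whereas that of \<open>E n\<close>
    exceeds \<open>d\<close> by less than \<open>1 / real (Suc n)\<close>.\<close>
  have near_orth: "(ip (E n) t)\<^sup>2 \<le> 1 / real (Suc n) * ip t t" if t: "t \<in> S" for n t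
  proof (rule discriminant_nonpos)
    have tH: "t \<in> H" using t S(1) by blast
    show "0 \<le> ip t t" using tH by (rule ip_nonneg)
    fix r :: real
    have "d \<le> Q (\<lambda>y. 1 * s n y + r * t y)" using sS t by (intro d_le S(2))
    also have "Q (\<lambda>y. 1 * s n y + r * t y) = ip (\<lambda>y. 1 * E n y + (- r) * t y) (\<lambda>y. 1 * E n y + (- r) * t y)"
      unfolding Q_def E_def by (simp add: algebra_simps)
    also have "\<dots> = ip (E n) (E n) - 2 * r * ip (E n) t + r\<^sup>2 * ip t t"
      by (subst ip_comb_self[OF EH tH]) simp
    finally show "0 \<le> 1 / real (Suc n) - 2 * r * ip (E n) t + r\<^sup>2 * ip t t"
      using E_lt[of n] by linarith
  qed
  \<comment> \<open>The parallelogram law: the midpoint of two approximants lies in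
    \<open>S\<close>, so its squared error is at least \<open>d\<close>.\<close>
  have close: "ip (\<lambda>y. E m y - E n y) (\<lambda>y. E m y - E n y) \<le> 2 / real (Suc m) + 2 / real (Suc n)" for m n
  proof -
    have "d \<le> Q (\<lambda>y. (1/2) * s m y + (1/2) * s n y)" using sS by (intro d_le S(2))
    also have "Q (\<lambda>y. (1/2) * s m y + (1/2) * s n y)
      = ip (\<lambda>y. (1/2) * E m y + (1/2) * E n y) (\<lambda>y. (1/2) * E m y + (1/2) * E n y)"
      unfolding Q_def E_def by (simp add: algebra_simps)
    also have "\<dots> = ip (E m) (E m) / 4 + ip (E m) (E n) / 2 + ip (E n) (E n) / 4"
      by (subst ip_comb_self[OF EH EH]) (simp add: power2_eq_square)
    finally have "d \<le> ip (E m) (E m) / 4 + ip (E m) (E n) / 2 + ip (E n) (E n) / 4" .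
    then show ?thesis
      using E_lt[of m] E_lt[of n] unfolding ip_diff_self[OF EH EH] by simp
  qed
  have "\<exists>N. \<forall>m\<ge>N. \<forall>n\<ge>N. sqrt (ip (\<lambda>y. E m y - E n y) (\<lambda>y. E m y - E n y)) < r" if r: "0 < r" for r
  proof -
    have "0 < r\<^sup>2 / 4" using r by simp
    then obtain N where N: "inverse (real (Suc N)) < r\<^sup>2 / 4" using reals_Archimedean by blast
    have "sqrt (ip (\<lambda>y. E m y - E n y) (\<lambda>y. E m y - E n y)) < r" if "m \<ge> N" "n \<ge> N" for m n
    proof -
      have "1 / real (Suc m) \<le> 1 / real (Suc N)" "1 / real (Suc n) \<le> 1 / real (Suc N)"
        using that by (simp_all add: divide_simps)
      then have "ip (\<lambda>y. E m y - E n y) (\<lambda>y. E m y - E n y) < r\<^sup>2"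
        using close[of m n] N by (simp add: inverse_eq_divide)
      then show ?thesis using r by (simp add: real_less_lsqrt)
    qed
    then show ?thesis by blast
  qed
  then obtain E' where E'H: "E' \<in> H"
    and lim: "(\<lambda>n. sqrt (ip (\<lambda>y. E n y - E' y) (\<lambda>y. E n y - E' y))) \<longlonglongrightarrow> 0"
    using rkhs EH unfolding is_rkhs_def by blast
  \<comment> \<open>Convergence in norm implies convergence of point values, since evaluation at
    \<open>x\<close> is pairing with the kernel section. Outside \<open>X\<close> the members of
    \<open>H\<close> vanish by convention.\<close>
  have "E' x = 0" for x
  proof (cases "x \<in> X")
    case True
    let ?K = "kernel_section X k x"
    have KH: "?K \<in> H" using K[OF True] S(1) by blast
    have repr: "ip f ?K = f x" if "f \<in> H" for f
      using rkhs True that unfolding is_rkhs_def by blast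
    have "(\<lambda>n. (E n x)\<^sup>2) \<longlonglongrightarrow> 0"
    proof (rule Lim_null_comparison)
      show "eventually (\<lambda>n. norm ((E n x)\<^sup>2) \<le> 1 / real (Suc n) * ip ?K ?K) sequentially"
        using near_orth[OF K[OF True]] repr[OF EH] by simp
      show "(\<lambda>n. 1 / real (Suc n) * ip ?K ?K) \<longlonglongrightarrow> 0"
        by (intro tendsto_mult_left_zero LIMSEQ_Suc lim_1_over_n)
    qed
    then have "(\<lambda>n. E n x) \<longlonglongrightarrow> 0" by simp
    moreover have "(\<lambda>n. (E n x - E' x)\<^sup>2) \<longlonglongrightarrow> 0"
    proof (rule Lim_null_comparison)
      let ?I = "\<lambda>n. ip (\<lambda>y. E n y - E' y) (\<lambda>y. E n y - E' y)"
      show "eventually (\<lambda>n. norm ((E n x - E' x)\<^sup>2) \<le> (sqrt (?I n))\<^sup>2 * ip ?K ?K) sequentially"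
        using Cauchy_Schwarz_ip[OF diff_closed[OF EH E'H] KH] repr[OF diff_closed[OF EH E'H]]
          ip_nonneg[OF diff_closed[OF EH E'H]] by simp
      show "(\<lambda>n. (sqrt (?I n))\<^sup>2 * ip ?K ?K) \<longlonglongrightarrow> 0"
        using lim by (intro tendsto_mult_left_zero) simp
    qed
    then have "(\<lambda>n. E n x - E' x) \<longlonglongrightarrow> 0" by simp
    then have "(\<lambda>n. E n x) \<longlonglongrightarrow> E' x" by (simp add: LIM_zero_iff)
    ultimately show ?thesis using LIMSEQ_unique by blast
  next
    case False
    then show ?thesis using rkhs E'H unfolding is_rkhs_def by blast
  qed
  then have "(\<lambda>n. sqrt (ip (E n) (E n))) \<longlonglongrightarrow> 0" using lim by simp
  then have "eventually (\<lambda>n. sqrt (ip (E n) (E n)) < sqrt e) sequentially"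
    by (rule order_tendstoD) (use e in simp)
  then obtain n where "sqrt (ip (E n) (E n)) < sqrt e" by (auto simp: eventually_sequentially)
  then show ?thesis using sS[of n] by (auto simp: E_def)
qed

section \<open>Square integrable functions and completeness\<close>

definition L2_functions :: "'a measure \<Rightarrow> ('a \<Rightarrow> real) set" where
  "L2_functions M = {v \<in> borel_measurable M. integrable M (\<lambda>x. (v x)\<^sup>2)}"

lemma L2_functions_mult_integrable:
  assumes "v \<in> L2_functions M" "w \<in> L2_functions M"
  shows "integrable M (\<lambda>x. v x * w x)"
proof (rule Bochner_Integration.integrable_bound)
  show "integrable M (\<lambda>x. (v x)\<^sup>2 + (w x)\<^sup>2)" using assms by (simp add: L2_functions_def)
  show "AE x in M. norm (v x * w x) \<le> norm ((v x)\<^sup>2 + (w x)\<^sup>2)"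
  proof (rule AE_I2)
    fix x
    have "2 * \<bar>v x * w x\<bar> \<le> (v x)\<^sup>2 + (w x)\<^sup>2"
      using sum_squares_bound[of "\<bar>v x\<bar>" "\<bar>w x\<bar>"] by (simp add: abs_mult)
    then show "norm (v x * w x) \<le> norm ((v x)\<^sup>2 + (w x)\<^sup>2)"
      using abs_ge_zero[of "v x * w x"] by simp
  qed
qed (use assms in \<open>auto simp: L2_functions_def\<close>)

lemma semi_inner_L2:
  "semi_inner_function_space (L2_functions M) (\<lambda>v w. \<integral>x. v x * w x \<partial>M)"
proof
  fix v w :: "'a \<Rightarrow> real" and a b :: real
  assume vw: "v \<in> L2_functions M" "w \<in> L2_functions M"
  have "(\<lambda>x. (a * v x + b * w x)\<^sup>2)
    = (\<lambda>x. a\<^sup>2 * (v x)\<^sup>2 + 2 * a * b * (v x * w x) + b\<^sup>2 * (w x)\<^sup>2)"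
    by (simp add: power2_eq_square algebra_simps)
  then show "(\<lambda>x. a * v x + b * w x) \<in> L2_functions M"
    using vw L2_functions_mult_integrable[OF vw]
    by (auto simp: L2_functions_def intro!: borel_measurable_add borel_measurable_times)
  fix u assume u: "u \<in> L2_functions M"
  show "(\<integral>x. (a * v x + b * w x) * u x \<partial>M) = a * (\<integral>x. v x * u x \<partial>M) + b * (\<integral>x. w x * u x \<partial>M)"
    using L2_functions_mult_integrable[OF vw(1) u] L2_functions_mult_integrable[OF vw(2) u]
    by (simp add: distrib_right mult.assoc)
qed (simp_all add: mult.commute)

text \<open>On a space of infinite measure, square integrable increments need not be integrable.
  With a weight \<open>r\<close> growing geometrically in the index, control of the weighted squares
  still yields pointwise absolute summability.\<close>

lemma abs_le_weighted_square:
  fixes r t :: real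
  assumes "0 < r"
  shows "\<bar>t\<bar> \<le> r * t\<^sup>2 + 1 / r"
proof -
  have "2 * (r * \<bar>t\<bar>) \<le> (r * \<bar>t\<bar>)\<^sup>2 + 1"
    using sum_squares_bound[of "r * \<bar>t\<bar>" 1] by simp
  moreover have "0 \<le> r * \<bar>t\<bar>" using assms by simp
  ultimately have "r * \<bar>t\<bar> \<le> (r * \<bar>t\<bar>)\<^sup>2 + 1" by linarith
  also have "\<dots> = r * (r * t\<^sup>2 + 1 / r)"
    using assms by (simp add: power_mult_distrib distrib_left power2_eq_square[of r])
  finally show ?thesis using assms by simp
qed

text \<open>The increments are square integrable with weights \<open>2 ^ n\<close>, and \<open>\<bar>d\<bar> \<le> 2 ^ n d\<^sup>2 + 2 ^ -n\<close>
  makes them absolutely summable almost everywhere; Fatou's lemma bounds the distance to the limit.\<close>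

lemma L2_rapidly_Cauchy_limit:
  fixes v :: "nat \<Rightarrow> 'a \<Rightarrow> real"
  assumes v: "\<And>n. v n \<in> L2_functions M" and C: "0 \<le> C"
    and d: "\<And>n. sqrt (\<integral>x. (v (Suc n) x - v n x)\<^sup>2 \<partial>M) \<le> C * (1/2) ^ n"
  shows "\<exists>w\<in>L2_functions M. \<forall>n. sqrt (\<integral>x. (w x - v n x)\<^sup>2 \<partial>M) \<le> 2 * C * (1/2) ^ n"
proof -
  interpret semi_inner_function_space "L2_functions M" "\<lambda>v w. \<integral>x. v x * w x \<partial>M"
    by (rule semi_inner_L2)
  have sn: "seminorm u = sqrt (\<integral>x. (u x)\<^sup>2 \<partial>M)" for u
    by (simp add: seminorm_def power2_eq_square)
  have vm [measurable]: "v n \<in> borel_measurable M" for n using v by (simp add: L2_functions_def)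
  have dint: "integrable M (\<lambda>x. (v m x - v n x)\<^sup>2)" for m n
    using diff_closed[OF v v, of m n] by (simp add: L2_functions_def)
  \<comment> \<open>The bracket \<open>2 * (1/2) ^ m - 2 * (1/2) ^ n\<close> is the geometric sum of
    the step bounds from \<open>m\<close> to \<open>n - 1\<close>.\<close>
  have far: "sqrt (\<integral>x. (v n x - v m x)\<^sup>2 \<partial>M) \<le> C * (2 * (1/2) ^ m - 2 * (1/2) ^ n)" if "m \<le> n" for m n
    using that
  proof (induction n rule: dec_induct)
    case base
    then show ?case by simp
  next
    case (step n)
    have "sqrt (\<integral>x. (v (Suc n) x - v m x)\<^sup>2 \<partial>M)
      \<le> sqrt (\<integral>x. (v (Suc n) x - v n x)\<^sup>2 \<partial>M) + sqrt (\<integral>x. (v n x - v m x)\<^sup>2 \<partial>M)"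
      using seminorm_triangle[OF v[of "Suc n"] v[of n] v[of m]] unfolding sn .
    also have "\<dots> \<le> C * (1/2) ^ n + C * (2 * (1/2) ^ m - 2 * (1/2) ^ n)"
      using d step.IH by (rule add_mono)
    finally show ?case by (simp add: algebra_simps)
  qed
  have far': "(\<integral>x. (v n x - v m x)\<^sup>2 \<partial>M) \<le> (2 * C * (1/2) ^ m)\<^sup>2" if "m \<le> n" for m n
  proof -
    have "sqrt (\<integral>x. (v n x - v m x)\<^sup>2 \<partial>M) \<le> 2 * C * (1/2) ^ m"
    proof -
      have "C * (2 * (1/2) ^ m - 2 * (1/2) ^ n) \<le> C * (2 * (1/2) ^ m)"
        using C by (intro mult_left_mono) auto
      then show ?thesis using far[OF that] by (simp only: mult_ac)
    qed
    then show ?thesis by (rule sqrt_le_D)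
  qed
  \<comment> \<open>The weight \<open>2 ^ n\<close> is affordable: against squared norms of order
    \<open>(1/4) ^ n\<close> it leaves a convergent geometric series.\<close>
  have "(\<integral>\<^sup>+x. (\<Sum>n. ennreal (2 ^ n * (v (Suc n) x - v n x)\<^sup>2)) \<partial>M)
      = (\<Sum>n. \<integral>\<^sup>+x. ennreal (2 ^ n * (v (Suc n) x - v n x)\<^sup>2) \<partial>M)"
    by (rule nn_integral_suminf) simp
  also have "\<dots> \<le> (\<Sum>n. ennreal (4 * C\<^sup>2 * (1/2) ^ n))"
  proof (rule suminf_le)
    fix n
    have "(\<integral>\<^sup>+x. ennreal (2 ^ n * (v (Suc n) x - v n x)\<^sup>2) \<partial>M)
      = ennreal (\<integral>x. 2 ^ n * (v (Suc n) x - v n x)\<^sup>2 \<partial>M)"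
      using dint[of "Suc n" n] by (intro nn_integral_eq_integral) auto
    also have "\<dots> \<le> ennreal (2 ^ n * (2 * C * (1/2) ^ n)\<^sup>2)"
      using far'[of n "Suc n"] by (intro ennreal_leI) (simp add: mult_left_mono)
    also have "2 ^ n * (2 * C * (1/2) ^ n)\<^sup>2 = 4 * C\<^sup>2 * (1/2) ^ n"
      by (simp add: power_mult_distrib power2_eq_square power_divide)
    finally show "(\<integral>\<^sup>+x. ennreal (2 ^ n * (v (Suc n) x - v n x)\<^sup>2) \<partial>M) \<le> ennreal (4 * C\<^sup>2 * (1/2) ^ n)" .
  qed auto
  also have "\<dots> < \<infinity>"
    using C by (subst suminf_ennreal2) (auto intro!: summable_mult summable_geometric)
  finally have "(\<integral>\<^sup>+x. (\<Sum>n. ennreal (2 ^ n * (v (Suc n) x - v n x)\<^sup>2)) \<partial>M) \<noteq> \<infinity>" by simp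
  then have "AE x in M. (\<Sum>n. ennreal (2 ^ n * (v (Suc n) x - v n x)\<^sup>2)) \<noteq> \<infinity>"
    by (intro nn_integral_PInf_AE) auto
  then have conv: "AE x in M. (\<lambda>n. v n x) \<longlonglongrightarrow> lim (\<lambda>n. v n x)"
  proof eventually_elim
    case (elim x)
    let ?d = "\<lambda>n. v (Suc n) x - v n x"
    have "summable (\<lambda>n. 2 ^ n * (?d n)\<^sup>2)"
      using elim by (intro summable_suminf_not_top) auto
    then have "summable (\<lambda>n. 2 ^ n * (?d n)\<^sup>2 + (1/2) ^ n)"
      by (intro summable_add summable_geometric) auto
    moreover have "norm (?d n) \<le> 2 ^ n * (?d n)\<^sup>2 + (1/2) ^ n" for n
      using abs_le_weighted_square[of "2 ^ n" "?d n"] by (simp add: power_divide)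
    ultimately have "summable ?d" by (rule summable_comparison_test'[where N = 0])
    then have "convergent (\<lambda>n. \<Sum>k<n. ?d k)" by (simp add: summable_iff_convergent)
    then have "convergent (\<lambda>n. v n x - v 0 x)" by (simp only: sum_lessThan_telescope[of "\<lambda>n. v n x"])
    then have "convergent (\<lambda>n. (v n x - v 0 x) + v 0 x)" by (intro convergent_add convergent_const)
    then show ?case by (simp add: convergent_LIMSEQ_iff)
  qed
  \<comment> \<open>As \<open>lim\<close> is total, \<open>w\<close> is defined and measurable
    everywhere, although convergence is known only almost everywhere.\<close>
  define w where "w x = lim (\<lambda>n. v n x)" for x
  have wm [measurable]: "w \<in> borel_measurable M" unfolding w_def by measurable
  have fatou: "(\<integral>\<^sup>+x. ennreal ((w x - v m x)\<^sup>2) \<partial>M) \<le> ennreal ((2 * C * (1/2) ^ m)\<^sup>2)" for m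
  proof -
    have "(\<integral>\<^sup>+x. ennreal ((w x - v m x)\<^sup>2) \<partial>M) = (\<integral>\<^sup>+x. liminf (\<lambda>n. ennreal ((v n x - v m x)\<^sup>2)) \<partial>M)"
    proof (rule nn_integral_cong_AE)
      show "AE x in M. ennreal ((w x - v m x)\<^sup>2) = liminf (\<lambda>n. ennreal ((v n x - v m x)\<^sup>2))"
        using conv
      proof eventually_elim
        case (elim x)
        then have "(\<lambda>n. ennreal ((v n x - v m x)\<^sup>2)) \<longlonglongrightarrow> ennreal ((w x - v m x)\<^sup>2)"
          unfolding w_def by (intro tendsto_intros)
        then show ?case by (intro lim_imp_Liminf[symmetric] trivial_limit_sequentially)
      qed
    qed
    also have "\<dots> \<le> liminf (\<lambda>n. \<integral>\<^sup>+x. ennreal ((v n x - v m x)\<^sup>2) \<partial>M)"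
      by (rule nn_integral_liminf) simp
    \<comment> \<open>For the limsup, a bound valid from \<open>n = m\<close> onwards is
      enough.\<close>
    also have "\<dots> \<le> limsup (\<lambda>n. \<integral>\<^sup>+x. ennreal ((v n x - v m x)\<^sup>2) \<partial>M)"
      by (rule Liminf_le_Limsup) simp
    also have "\<dots> \<le> ennreal ((2 * C * (1/2) ^ m)\<^sup>2)"
    proof (rule Limsup_bounded)
      show "eventually (\<lambda>n. (\<integral>\<^sup>+x. ennreal ((v n x - v m x)\<^sup>2) \<partial>M) \<le> ennreal ((2 * C * (1/2) ^ m)\<^sup>2)) sequentially"
        using eventually_ge_at_top[of m]
      proof eventually_elim
        case (elim n)
        have "(\<integral>\<^sup>+x. ennreal ((v n x - v m x)\<^sup>2) \<partial>M) = ennreal (\<integral>x. (v n x - v m x)\<^sup>2 \<partial>M)"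
          using dint by (intro nn_integral_eq_integral) auto
        then show ?case using far'[OF elim] by (simp add: ennreal_leI)
      qed
    qed
    finally show ?thesis .
  qed
  have int: "integrable M (\<lambda>x. (w x - v m x)\<^sup>2)" for m
    using fatou[of m] by (intro integrableI_nonneg) (auto simp: top_unique less_top[symmetric])
  \<comment> \<open>The limit is recovered as \<open>(w - v 0) + v 0\<close>, a sum of two square
    integrable functions.\<close>
  have "(\<lambda>x. w x - v 0 x) \<in> L2_functions M" using int by (simp add: L2_functions_def)
  from comb_closed[OF this v, of 1 1 0] have w: "w \<in> L2_functions M" by simp
  have "sqrt (\<integral>x. (w x - v n x)\<^sup>2 \<partial>M) \<le> 2 * C * (1/2) ^ n" for n
  proof -
    have "ennreal (\<integral>x. (w x - v n x)\<^sup>2 \<partial>M) \<le> ennreal ((2 * C * (1/2) ^ n)\<^sup>2)"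
      using fatou[of n] by (subst nn_integral_eq_integral[symmetric, OF int]) auto
    then have "(\<integral>x. (w x - v n x)\<^sup>2 \<partial>M) \<le> (2 * C * (1/2) ^ n)\<^sup>2" by simp
    then show ?thesis using C by (intro real_le_lsqrt) auto
  qed
  with w show ?thesis by blast
qed

section \<open>Extension of densely defined bounded operators\<close>

text \<open>The relation \<open>Gr\<close> is not assumed single valued; \<open>graph_comb\<close>
  and \<open>graph_bound\<close> together imply it up to null sets.\<close>

locale dense_bounded_graph = semi_inner_function_space H ip
  for H :: "('s \<Rightarrow> real) set" and ip +
  fixes M :: "'a measure" and Gr :: "(('s \<Rightarrow> real) \<times> ('a \<Rightarrow> real)) set" and A :: real
  assumes A_nonneg: "0 \<le> A"
    and graph_domain: "\<And>s w. (s, w) \<in> Gr \<Longrightarrow> s \<in> H"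
    and graph_range: "\<And>s w. (s, w) \<in> Gr \<Longrightarrow> w \<in> L2_functions M"
    and graph_comb: "\<And>s w s' w' a b. (s, w) \<in> Gr \<Longrightarrow> (s', w') \<in> Gr \<Longrightarrow>
      ((\<lambda>y. a * s y + b * s' y), (\<lambda>x. a * w x + b * w' x)) \<in> Gr"
    and graph_bound: "\<And>s w. (s, w) \<in> Gr \<Longrightarrow> sqrt (\<integral>x. (w x)\<^sup>2 \<partial>M) \<le> A * sqrt (ip s s)"
    and graph_dense: "\<And>g e. g \<in> H \<Longrightarrow> 0 < e \<Longrightarrow>
      \<exists>s w. (s, w) \<in> Gr \<and> sqrt (ip (\<lambda>y. g y - s y) (\<lambda>y. g y - s y)) < e"
begin

sublocale L2: semi_inner_function_space "L2_functions M" "\<lambda>v w. \<integral>x. v x * w x \<partial>M"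
  by (rule semi_inner_L2)

lemma L2_seminorm_eq: "L2.seminorm u = sqrt (\<integral>x. (u x)\<^sup>2 \<partial>M)"
  by (simp add: L2.seminorm_def power2_eq_square)

lemma L2_seminorm_cong_AE:
  assumes "u \<in> borel_measurable M" "v \<in> borel_measurable M" "AE x in M. u x = v x"
  shows "L2.seminorm u = L2.seminorm v"
proof -
  have "(\<integral>x. (u x)\<^sup>2 \<partial>M) = (\<integral>x. (v x)\<^sup>2 \<partial>M)"
    by (rule integral_cong_AE) (use assms in auto)
  then show ?thesis by (simp add: L2_seminorm_eq)
qed

lemma graph_diff:
  "(s, w) \<in> Gr \<Longrightarrow> (s', w') \<in> Gr \<Longrightarrow> ((\<lambda>y. s y - s' y), (\<lambda>x. w x - w' x)) \<in> Gr"
  using graph_comb[of s w s' w' 1 "-1"] by simp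

lemma graph_bound': "(s, w) \<in> Gr \<Longrightarrow> L2.seminorm w \<le> A * seminorm s"
  using graph_bound by (simp add: L2_seminorm_eq seminorm_def)

text \<open>The closure of \<open>Gr\<close> in the product of the two seminormed spaces.\<close>

definition closure_graph :: "('s \<Rightarrow> real) \<Rightarrow> ('a \<Rightarrow> real) \<Rightarrow> bool" where
  "closure_graph g v \<longleftrightarrow> v \<in> L2_functions M \<and> (\<forall>e>0. \<exists>s w. (s, w) \<in> Gr \<and>
    seminorm (\<lambda>y. g y - s y) < e \<and> L2.seminorm (\<lambda>x. v x - w x) < e)"

lemma closure_graph_L2: "closure_graph g v \<Longrightarrow> v \<in> L2_functions M"
  by (simp add: closure_graph_def)

lemma closure_graphE:
  assumes "closure_graph g v" "0 < e"
  obtains s w where "(s, w) \<in> Gr" "seminorm (\<lambda>y. g y - s y) < e" "L2.seminorm (\<lambda>x. v x - w x) < e"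
  using assms unfolding closure_graph_def by blast

lemma graph_subset_closure_graph:
  assumes "(s, w) \<in> Gr"
  shows "closure_graph s w"
proof -
  have "seminorm (\<lambda>y. s y - s y) = 0"
    using graph_domain[OF assms] by (rule seminorm_diff_self)
  moreover have "L2.seminorm (\<lambda>x. w x - w x) = 0" by (simp add: L2_seminorm_eq)
  ultimately show ?thesis
    unfolding closure_graph_def using assms graph_range[OF assms]
    by (intro conjI allI impI exI[of _ s] exI[of _ w]) auto
qed

text \<open>Approximants at distance \<open>(1/2) ^ n\<close> have rapidly Cauchy images by the
  bound on \<open>Gr\<close>, so completeness supplies the value.\<close>

lemma closure_graph_exists:
  assumes g: "g \<in> H"
  shows "\<exists>v. closure_graph g v"
proof -
  have "\<exists>s w. (s, w) \<in> Gr \<and> seminorm (\<lambda>y. g y - s y) < (1/2) ^ n" for n :: nat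
    using graph_dense[OF g, of "(1/2) ^ n"] by (simp add: seminorm_def)
  then obtain s w where Gr: "\<And>n. (s n, w n) \<in> Gr"
    and close: "\<And>n :: nat. seminorm (\<lambda>y. g y - s n y) < (1/2) ^ n" by metis
  have sH: "s n \<in> H" and wL: "w n \<in> L2_functions M" for n
    using Gr graph_domain graph_range by blast+
  \<comment> \<open>The factor \<open>2 * A\<close> comes from
    \<open>(1/2) ^ Suc n + (1/2) ^ n \<le> 2 * (1/2) ^ n\<close>.\<close>
  have "sqrt (\<integral>x. (w (Suc n) x - w n x)\<^sup>2 \<partial>M) \<le> 2 * A * (1/2) ^ n" for n
  proof -
    have "seminorm (\<lambda>y. s (Suc n) y - s n y)
      \<le> seminorm (\<lambda>y. s (Suc n) y - g y) + seminorm (\<lambda>y. g y - s n y)"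
      using sH g sH by (rule seminorm_triangle)
    also have "\<dots> \<le> (1/2) ^ Suc n + (1/2) ^ n"
      using close[of n] close[of "Suc n"] seminorm_diff_commute[OF sH g, of "Suc n"] by linarith
    also have "\<dots> \<le> 2 * (1/2) ^ n" by simp
    finally have "A * seminorm (\<lambda>y. s (Suc n) y - s n y) \<le> A * (2 * (1/2) ^ n)"
      using A_nonneg by (rule mult_left_mono)
    then show ?thesis
      using graph_bound'[OF graph_diff[OF Gr Gr], of "Suc n" n] unfolding L2_seminorm_eq by simp
  qed
  then obtain v where v: "v \<in> L2_functions M"
    and lim: "\<And>n. sqrt (\<integral>x. (v x - w n x)\<^sup>2 \<partial>M) \<le> 2 * (2 * A) * (1/2) ^ n"
    using L2_rapidly_Cauchy_limit[of w M "2 * A"] wL A_nonneg by auto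
  have "\<exists>s w. (s, w) \<in> Gr \<and> seminorm (\<lambda>y. g y - s y) < e \<and> L2.seminorm (\<lambda>x. v x - w x) < e"
    if e: "0 < e" for e
  proof -
    \<comment> \<open>The denominator makes one \<open>n\<close> serve both
      \<open>(1/2) ^ n < e\<close> and \<open>4 * A * (1/2) ^ n < e\<close>.\<close>
    have "0 < e / (4 * A + 1)" using e A_nonneg by simp
    then obtain n where n: "(1/2) ^ n < e / (4 * A + 1)"
      using real_arch_pow_inv[of "e / (4 * A + 1)" "1/2"] by auto
    then have "(4 * A + 1) * (1/2) ^ n < e"
      using A_nonneg by (simp add: pos_less_divide_eq mult.commute)
    moreover have "0 \<le> 4 * A * (1/2) ^ n" "0 < (1/2 :: real) ^ n" using A_nonneg by auto
    ultimately have "(1/2) ^ n < e" "2 * (2 * A) * (1/2) ^ n < e"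
      unfolding distrib_right by linarith+
    then show ?thesis
      using Gr[of n] close[of n] lim[of n] unfolding L2_seminorm_eq
      by (intro exI[of _ "s n"] exI[of _ "w n"]) linarith
  qed
  with v have "closure_graph g v" by (simp add: closure_graph_def)
  then show ?thesis by blast
qed

lemma closure_graph_comb:
  assumes g: "g \<in> H" "g' \<in> H" and cl: "closure_graph g v" "closure_graph g' v'"
  shows "closure_graph (\<lambda>y. a * g y + b * g' y) (\<lambda>x. a * v x + b * v' x)"
  unfolding closure_graph_def
proof (intro conjI allI impI)
  have L: "v \<in> L2_functions M" "v' \<in> L2_functions M" using cl closure_graph_L2 by blast+
  then show "(\<lambda>x. a * v x + b * v' x) \<in> L2_functions M" by (rule L2.comb_closed)
  fix e :: real assume e: "0 < e"
  \<comment> \<open>The summand 1 keeps the denominator positive for \<open>a = b = 0\<close> and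
    makes the final estimate strict.\<close>
  define r where "r = e / (\<bar>a\<bar> + \<bar>b\<bar> + 1)"
  have r: "0 < r" using e by (simp add: r_def)
  obtain s w where 1: "(s, w) \<in> Gr" "seminorm (\<lambda>y. g y - s y) < r" "L2.seminorm (\<lambda>x. v x - w x) < r"
    using cl(1) r by (rule closure_graphE)
  obtain s' w' where 2: "(s', w') \<in> Gr" "seminorm (\<lambda>y. g' y - s' y) < r" "L2.seminorm (\<lambda>x. v' x - w' x) < r"
    using cl(2) r by (rule closure_graphE)
  have small: "\<bar>a\<bar> * p + \<bar>b\<bar> * q < e" if "p < r" "q < r" for p q
  proof -
    have "\<bar>a\<bar> * p + \<bar>b\<bar> * q \<le> \<bar>a\<bar> * r + \<bar>b\<bar> * r"
      using that by (intro add_mono mult_left_mono) auto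
    also have "\<dots> < (\<bar>a\<bar> + \<bar>b\<bar> + 1) * r" using r by (simp add: distrib_right)
    also have "\<dots> = e" unfolding r_def by (simp add: add_nonneg_eq_0_iff)
    finally show ?thesis .
  qed
  have "seminorm (\<lambda>y. a * (g y - s y) + b * (g' y - s' y)) < e"
    using seminorm_comb_le[OF diff_closed[OF g(1) graph_domain[OF 1(1)]]
        diff_closed[OF g(2) graph_domain[OF 2(1)]]] small[OF 1(2) 2(2)]
    by (rule le_less_trans)
  moreover have "L2.seminorm (\<lambda>x. a * (v x - w x) + b * (v' x - w' x)) < e"
    using L2.seminorm_comb_le[OF L2.diff_closed[OF L(1) graph_range[OF 1(1)]]
        L2.diff_closed[OF L(2) graph_range[OF 2(1)]]] small[OF 1(3) 2(3)]
    by (rule le_less_trans)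
  ultimately show "\<exists>s w. (s, w) \<in> Gr \<and> seminorm (\<lambda>y. a * g y + b * g' y - s y) < e
    \<and> L2.seminorm (\<lambda>x. a * v x + b * v' x - w x) < e"
    using graph_comb[OF 1(1) 2(1), of a b]
    by (intro exI[of _ "\<lambda>y. a * s y + b * s' y"] exI[of _ "\<lambda>x. a * w x + b * w' x"] conjI)
      (simp_all add: algebra_simps)
qed

lemma closure_graph_bound:
  assumes g: "g \<in> H" and cl: "closure_graph g v"
  shows "L2.seminorm v \<le> A * seminorm g"
proof (rule field_le_epsilon)
  fix e :: real assume e: "0 < e"
  \<comment> \<open>An error \<open>r\<close> in the domain costs \<open>A * r\<close>, one in the
    range costs \<open>r\<close>; together they make \<open>e\<close>.\<close>
  define r where "r = e / (A + 1)"
  have r: "0 < r" "(A + 1) * r = e" using e A_nonneg by (simp_all add: r_def)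
  obtain s w where sw: "(s, w) \<in> Gr" "seminorm (\<lambda>y. g y - s y) < r" "L2.seminorm (\<lambda>x. v x - w x) < r"
    using cl r(1) by (rule closure_graphE)
  note sH = graph_domain[OF sw(1)] and wL = graph_range[OF sw(1)]
  have "seminorm s \<le> seminorm g + seminorm (\<lambda>y. g y - s y)"
    using seminorm_diff_le[OF g diff_closed[OF g sH]] by simp
  then have "A * seminorm s \<le> A * (seminorm g + r)"
    using sw(2) A_nonneg by (intro mult_left_mono) auto
  moreover have "L2.seminorm v \<le> L2.seminorm (\<lambda>x. v x - w x) + L2.seminorm w"
    using L2.seminorm_comb_le[OF L2.diff_closed[OF closure_graph_L2[OF cl] wL] wL, of 1 1] by simp
  ultimately show "L2.seminorm v \<le> A * seminorm g + e"
    using graph_bound'[OF sw(1)] sw(3) r(2) by (simp add: distrib_left distrib_right)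
qed

text \<open>The difference of two values lies over the zero function by linearity of the closure,
  and the bound gives it seminorm 0.\<close>

lemma closure_graph_unique:
  assumes g: "g \<in> H" and cl: "closure_graph g v" "closure_graph g v'"
  shows "AE x in M. v x = v' x"
proof -
  have L: "v \<in> L2_functions M" "v' \<in> L2_functions M" using cl closure_graph_L2 by blast+
  have "closure_graph (\<lambda>y. g y - g y) (\<lambda>x. v x - v' x)"
    using closure_graph_comb[OF g g cl, of 1 "-1"] by simp
  with diff_closed[OF g g] have "L2.seminorm (\<lambda>x. v x - v' x) \<le> A * seminorm (\<lambda>y. g y - g y)"
    by (rule closure_graph_bound)
  also have "seminorm (\<lambda>y. g y - g y) = 0" using g by (rule seminorm_diff_self)
  finally have "(\<integral>x. (v x - v' x)\<^sup>2 \<partial>M) \<le> 0"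
    by (simp add: L2_seminorm_eq)
  then have "(\<integral>x. (v x - v' x)\<^sup>2 \<partial>M) = 0"
    by (intro antisym integral_nonneg) auto
  moreover have "integrable M (\<lambda>x. (v x - v' x)\<^sup>2)"
    using L2.diff_closed[OF L] by (simp add: L2_functions_def)
  ultimately have "AE x in M. (v x - v' x)\<^sup>2 = 0"
    by (subst (asm) integral_nonneg_eq_0_iff_AE) auto
  then show ?thesis by simp
qed

text \<open>The representative is chosen for each \<open>g\<close> separately, so linearity can be
  expected only almost everywhere.\<close>

definition extension :: "('s \<Rightarrow> real) \<Rightarrow> 'a \<Rightarrow> real" where
  "extension g = (SOME v. closure_graph g v)"

lemma closure_graph_extension: "g \<in> H \<Longrightarrow> closure_graph g (extension g)"
  unfolding extension_def using closure_graph_exists by (rule someI_ex)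

lemma extension_L2: "g \<in> H \<Longrightarrow> extension g \<in> L2_functions M"
  using closure_graph_extension closure_graph_L2 by blast

lemma extension_bound:
  "g \<in> H \<Longrightarrow> sqrt (\<integral>x. (extension g x)\<^sup>2 \<partial>M) \<le> A * sqrt (ip g g)"
  using closure_graph_bound closure_graph_extension by (simp add: L2_seminorm_eq seminorm_def)

lemma extension_comb:
  "g \<in> H \<Longrightarrow> g' \<in> H \<Longrightarrow>
    AE x in M. extension (\<lambda>y. a * g y + b * g' y) x = a * extension g x + b * extension g' x"
  by (rule closure_graph_unique[OF comb_closed closure_graph_extension[OF comb_closed]
        closure_graph_comb[OF _ _ closure_graph_extension closure_graph_extension]])

lemma extension_graph: "(s, w) \<in> Gr \<Longrightarrow> AE x in M. extension s x = w x"
  by (rule closure_graph_unique)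
    (auto intro: closure_graph_extension graph_subset_closure_graph graph_domain)

text \<open>Approximating \<open>g\<close> from the domain of \<open>Gr\<close> shows that the pair
  of \<open>g\<close> and \<open>R g\<close> belongs to the closure, whose values are unique. The
  constant \<open>K\<close> is unrelated to \<open>A\<close> and may be negative, hence
  \<open>\<bar>K\<bar>\<close> in the estimates.\<close>

lemma extension_unique:
  assumes L: "\<And>g. g \<in> H \<Longrightarrow> R g \<in> L2_functions M"
    and lin: "\<And>g g' a b. g \<in> H \<Longrightarrow> g' \<in> H \<Longrightarrow>
      AE x in M. R (\<lambda>y. a * g y + b * g' y) x = a * R g x + b * R g' x"
    and bound: "\<And>g. g \<in> H \<Longrightarrow> sqrt (\<integral>x. (R g x)\<^sup>2 \<partial>M) \<le> K * sqrt (ip g g)"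
    and graph: "\<And>s w. (s, w) \<in> Gr \<Longrightarrow> AE x in M. R s x = w x"
    and g: "g \<in> H"
  shows "AE x in M. R g x = extension g x"
proof (rule closure_graph_unique[OF g _ closure_graph_extension[OF g]])
  show "closure_graph g (R g)"
    unfolding closure_graph_def
  proof (intro conjI allI impI L[OF g])
    fix e :: real assume e: "0 < e"
    define r where "r = e / (\<bar>K\<bar> + 1)"
    have r: "0 < r" "(\<bar>K\<bar> + 1) * r = e" using e by (simp_all add: r_def add_nonneg_eq_0_iff)
    obtain s w where sw: "(s, w) \<in> Gr" "seminorm (\<lambda>y. g y - s y) < r"
      using graph_dense[OF g r(1)] by (auto simp: seminorm_def)
    note sH = graph_domain[OF sw(1)] and wL = graph_range[OF sw(1)]
    have "AE x in M. R (\<lambda>y. g y - s y) x = R g x - R s x"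
      using lin[OF g sH, of 1 "-1"] by simp
    then have "AE x in M. R g x - w x = R (\<lambda>y. g y - s y) x"
      using graph[OF sw(1)] by eventually_elim simp
    then have "L2.seminorm (\<lambda>x. R g x - w x) = L2.seminorm (R (\<lambda>y. g y - s y))"
      using L2.diff_closed[OF L[OF g] wL] L[OF diff_closed[OF g sH]]
      by (intro L2_seminorm_cong_AE) (auto simp: L2_functions_def)
    also have "\<dots> \<le> K * seminorm (\<lambda>y. g y - s y)"
      using bound[OF diff_closed[OF g sH]] by (simp add: L2_seminorm_eq seminorm_def)
    also have "\<dots> \<le> \<bar>K\<bar> * seminorm (\<lambda>y. g y - s y)"
      using seminorm_nonneg[OF diff_closed[OF g sH]] by (intro mult_right_mono) auto
    also have "\<dots> \<le> \<bar>K\<bar> * r" using sw(2) by (intro mult_left_mono) auto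
    also have "\<dots> < e" using r by (simp add: distrib_right)
    finally have "L2.seminorm (\<lambda>x. R g x - w x) < e" .
    moreover have "r \<le> e"
      using mult_right_mono[of 1 "\<bar>K\<bar> + 1" r] r by simp
    ultimately show "\<exists>s w. (s, w) \<in> Gr \<and> seminorm (\<lambda>y. g y - s y) < e
        \<and> L2.seminorm (\<lambda>x. R g x - w x) < e"
      using sw by (intro exI[of _ s] exI[of _ w]) auto
  qed
qed

end

section \<open>Kronecker powers\<close>

lemma multi_idx_0: "multi_idx 0 = {[]}"
  by (simp add: multi_idx_def)

lemma sum_multi_idx_Suc:
  fixes g :: "'n::finite list \<Rightarrow> real"
  shows "(\<Sum>J\<in>multi_idx (Suc p). g J) = (\<Sum>j\<in>UNIV. \<Sum>J\<in>multi_idx p. g (j # J))"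
proof -
  have "multi_idx (Suc p) = (\<lambda>(j, J). j # J) ` ((UNIV :: 'n set) \<times> multi_idx p)"
    by (auto simp: multi_idx_def length_Suc_conv image_iff)
  moreover have "inj_on (\<lambda>(j, J). j # J) ((UNIV :: 'n set) \<times> multi_idx p)"
    by (auto simp: inj_on_def)
  ultimately show ?thesis
    by (simp add: sum.reindex sum.cartesian_product case_prod_unfold)
qed

lemma kron_pow_Cons:
  assumes "length J = p" "length K = p"
  shows "kron_pow M (Suc p) (j # J) (k # K) = M $ j $ k * kron_pow M p J K"
  using assms by (simp add: kron_pow_def prod.lessThan_Suc_shift del: prod.lessThan_Suc)

text \<open>On matrices \<bullet> is the Frobenius inner product, and splitting off the first letter
  of both multi-indices produces one factor of it. Powers of traces in the kernel thus become inner
  products of Kronecker powers; for \<open>p = 0\<close> the empty multi-index gives 1.\<close>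

lemma tr_AtB_kron_pow: "tr_AtB p (kron_pow F p) (kron_pow G p) = (F \<bullet> G) ^ p"
  for F G :: "real^'n^'n"
proof (induction p)
  case 0
  show ?case by (simp add: tr_AtB_def multi_idx_0 kron_pow_def)
next
  case (Suc p)
  have "tr_AtB (Suc p) (kron_pow F (Suc p)) (kron_pow G (Suc p))
    = (\<Sum>j\<in>UNIV. \<Sum>J\<in>multi_idx p. \<Sum>k\<in>UNIV. \<Sum>K\<in>multi_idx p.
        (F $ j $ k * G $ j $ k) * (kron_pow F p J K * kron_pow G p J K))"
    unfolding tr_AtB_def sum_multi_idx_Suc
    by (intro sum.cong refl) (simp add: kron_pow_Cons multi_idx_def)
  also have "\<dots> = (\<Sum>j\<in>UNIV. \<Sum>k\<in>UNIV. \<Sum>J\<in>multi_idx p. \<Sum>K\<in>multi_idx p.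
        (F $ j $ k * G $ j $ k) * (kron_pow F p J K * kron_pow G p J K))"
    by (intro sum.cong refl sum.swap)
  also have "\<dots> = (\<Sum>j\<in>UNIV. \<Sum>k\<in>UNIV. F $ j $ k * G $ j $ k) * tr_AtB p (kron_pow F p) (kron_pow G p)"
    unfolding tr_AtB_def sum_distrib_left[symmetric] sum_distrib_right[symmetric] ..
  finally show ?case by (simp add: Suc.IH inner_vec_def)
qed

lemma trace_mult_symmetric:
  fixes F G :: "real^'n^'n"
  assumes "transpose G = G"
  shows "trace (F ** G) = F \<bullet> G"
proof -
  have "G $ k $ j = G $ j $ k" for j k
    using assms by (metis transpose_def vec_lambda_beta)
  then show ?thesis by (simp add: trace_def matrix_matrix_mult_def inner_vec_def)
qed

lemma frob_sq_eq_tr_AtB: "frob_sq p V = tr_AtB p V V"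
  by (simp add: frob_sq_def tr_AtB_def power2_eq_square)

lemma frob_sq_nonneg: "0 \<le> frob_sq p V"
  by (simp add: frob_sq_def sum_nonneg)

lemma tr_AtB_commute: "tr_AtB p W V = tr_AtB p V W"
  by (simp add: tr_AtB_def mult.commute)

lemma tr_AtB_cmult: "tr_AtB p W (\<lambda>J K. a * V J K) = a * tr_AtB p W V"
  by (simp add: tr_AtB_def sum_distrib_left mult_ac)

lemma tr_AtB_sum:
  "tr_AtB p W (\<lambda>J K. \<Sum>q\<in>Q. \<alpha> q * V q J K) = (\<Sum>q\<in>Q. \<alpha> q * tr_AtB p W (V q))"
proof (induction Q rule: infinite_finite_induct)
  case (insert q Q)
  then show ?case
    by (simp add: tr_AtB_def distrib_left sum.distrib sum_distrib_left mult_ac)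
qed (simp_all add: tr_AtB_def)

lemma frob_sq_sum:
  "frob_sq p (\<lambda>J K. \<Sum>q\<in>Q. \<alpha> q * V q J K)
    = (\<Sum>q\<in>Q. \<Sum>r\<in>Q. \<alpha> q * \<alpha> r * tr_AtB p (V q) (V r))"
  unfolding frob_sq_eq_tr_AtB tr_AtB_sum tr_AtB_commute[of p "\<lambda>J K. \<Sum>q\<in>Q. \<alpha> q * V q J K"]
  by (simp add: sum_distrib_left mult_ac tr_AtB_commute)

lemma frob_sq_diff:
  "frob_sq p (\<lambda>J K. W J K - r * V J K) = frob_sq p W - 2 * r * tr_AtB p W V + r\<^sup>2 * frob_sq p V"
  by (simp add: frob_sq_def tr_AtB_def sum_distrib_left sum_subtractf[symmetric] sum.distrib[symmetric]
      power2_diff power_mult_distrib mult_ac)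
    (intro sum.cong refl, simp add: algebra_simps)

lemma abs_tr_AtB_le: "\<bar>tr_AtB p W V\<bar> \<le> (frob_sq p W + frob_sq p V) / 2"
  using frob_sq_nonneg[of p "\<lambda>J K. W J K - 1 * V J K"] frob_sq_nonneg[of p "\<lambda>J K. W J K - (-1) * V J K"]
  unfolding frob_sq_diff by (simp add: abs_le_iff)

text \<open>The component of a family at \<open>(i, p)\<close> is read as a \<open>d^p x d^p\<close> matrix.\<close>

definition fam_inner :: "(nat \<times> nat \<Rightarrow> ('n::finite) kmat) \<Rightarrow> (nat \<times> nat \<Rightarrow> 'n kmat) \<Rightarrow> real" where
  "fam_inner W V = (\<Sum>\<^sub>\<infinity>z. tr_AtB (snd z) (W z) (V z))"

definition fam_summable :: "(nat \<times> nat \<Rightarrow> ('n::finite) kmat) \<Rightarrow> bool" where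
  "fam_summable W \<longleftrightarrow> (\<lambda>z. frob_sq (snd z) (W z)) summable_on UNIV"

text \<open>Each term is bounded by the mean of the two Frobenius squares, so square summability of
  both families gives absolute summability.\<close>

lemma fam_inner_has_sum:
  assumes "fam_summable W" "fam_summable V"
  shows "((\<lambda>z. tr_AtB (snd z) (W z) (V z)) has_sum fam_inner W V) UNIV"
proof -
  have "(\<lambda>z. (1/2) * (frob_sq (snd z) (W z) + frob_sq (snd z) (V z))) summable_on UNIV"
    using assms unfolding fam_summable_def by (intro summable_on_cmult_right summable_on_add)
  then have "(\<lambda>z. norm (tr_AtB (snd z) (W z) (V z))) summable_on UNIV"
    by (rule summable_on_comparison_test) (use abs_tr_AtB_le in \<open>simp_all\<close>)
  then have "(\<lambda>z. tr_AtB (snd z) (W z) (V z)) summable_on UNIV"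
    by (rule abs_summable_summable)
  then show ?thesis by (simp add: fam_inner_def)
qed

lemma fam_inner_self: "fam_inner W W = (\<Sum>\<^sub>\<infinity>z. frob_sq (snd z) (W z))"
  by (simp add: fam_inner_def frob_sq_eq_tr_AtB)

lemma fam_inner_nonneg: "0 \<le> fam_inner W W"
  unfolding fam_inner_self by (simp add: infsum_nonneg frob_sq_nonneg)

lemma fam_inner_diff_nonneg:
  assumes "fam_summable W" "fam_summable V"
  shows "0 \<le> fam_inner W W - 2 * r * fam_inner W V + r\<^sup>2 * fam_inner V V"
proof -
  have "((\<lambda>z. tr_AtB (snd z) (W z) (W z) + (- 2 * r) * tr_AtB (snd z) (W z) (V z)
      + r\<^sup>2 * tr_AtB (snd z) (V z) (V z)) has_sum
      (fam_inner W W + (- 2 * r) * fam_inner W V + r\<^sup>2 * fam_inner V V)) UNIV"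
    using assms by (intro has_sum_add has_sum_cmult_right fam_inner_has_sum)
  moreover have "0 \<le> tr_AtB (snd z) (W z) (W z) + (- 2 * r) * tr_AtB (snd z) (W z) (V z)
      + r\<^sup>2 * tr_AtB (snd z) (V z) (V z)" for z
    using frob_sq_nonneg[of "snd z" "\<lambda>J K. W z J K - r * V z J K"]
    unfolding frob_sq_diff frob_sq_eq_tr_AtB by simp
  ultimately have "0 \<le> fam_inner W W + (- 2 * r) * fam_inner W V + r\<^sup>2 * fam_inner V V"
    by (rule has_sum_nonneg)
  then show ?thesis by simp
qed

lemma abs_fam_inner_le:
  assumes "fam_summable W" "fam_summable V"
  shows "\<bar>fam_inner W V\<bar> \<le> (fam_inner W W + fam_inner V V) / 2"
  using fam_inner_diff_nonneg[OF assms, of 1] fam_inner_diff_nonneg[OF assms, of "-1"]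
  by (simp add: abs_le_iff)

lemma has_sum_finite_sum:
  fixes g :: "'q \<Rightarrow> 'z \<Rightarrow> real"
  assumes "finite Q" "\<And>q. q \<in> Q \<Longrightarrow> (g q has_sum S q) B"
  shows "((\<lambda>z. \<Sum>q\<in>Q. g q z) has_sum (\<Sum>q\<in>Q. S q)) B"
  using assms by (induction Q) (auto intro!: has_sum_add)

text \<open>The family \<open>U\<close> will be the feature vector of a finite combination of
  states; its squared norm is the Gram form of the individual feature vectors.\<close>

lemma fam_comb:
  fixes \<alpha> :: "'q \<Rightarrow> real" and V :: "'q \<Rightarrow> nat \<times> nat \<Rightarrow> ('n::finite) kmat"
  assumes Q: "finite Q" and V: "\<And>q. q \<in> Q \<Longrightarrow> fam_summable (V q)"
  defines "U \<equiv> (\<lambda>z J K. \<Sum>q\<in>Q. \<alpha> q * V q z J K)"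
  shows "fam_summable U"
    and "fam_inner U U = (\<Sum>q\<in>Q. \<Sum>r\<in>Q. \<alpha> q * \<alpha> r * fam_inner (V q) (V r))"
    and "fam_summable W \<Longrightarrow> fam_inner W U = (\<Sum>q\<in>Q. \<alpha> q * fam_inner W (V q))"
proof -
  have "((\<lambda>z. frob_sq (snd z) (U z)) has_sum
      (\<Sum>q\<in>Q. \<Sum>r\<in>Q. \<alpha> q * \<alpha> r * fam_inner (V q) (V r))) UNIV"
    unfolding U_def frob_sq_sum
    by (intro has_sum_finite_sum has_sum_cmult_right fam_inner_has_sum V Q)
  then show "fam_summable U" "fam_inner U U = (\<Sum>q\<in>Q. \<Sum>r\<in>Q. \<alpha> q * \<alpha> r * fam_inner (V q) (V r))"
    unfolding fam_summable_def fam_inner_self by (auto simp: summable_on_def infsumI)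
  assume W: "fam_summable W"
  have "((\<lambda>z. tr_AtB (snd z) (W z) (U z)) has_sum (\<Sum>q\<in>Q. \<alpha> q * fam_inner W (V q))) UNIV"
    unfolding U_def tr_AtB_sum
    by (intro has_sum_finite_sum has_sum_cmult_right fam_inner_has_sum V W Q)
  then show "fam_inner W U = (\<Sum>q\<in>Q. \<alpha> q * fam_inner W (V q))"
    unfolding fam_inner_def by (rule infsumI)
qed

text \<open>The quadratic in \<open>t\<close> is a sum of two squared norms, \<open>1/2\<close>
  times that of \<open>2 *\<^sub>R a - t *\<^sub>R v\<close> and \<open>2 / \<theta>\<close> times
  that of \<open>W - (t * \<theta> / 2) * V\<close>, so the discriminant bound applies without
  forming a product space.\<close>

lemma weighted_Cauchy_Schwarz:
  fixes a v :: "'e::real_inner"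
  assumes \<theta>: "0 < \<theta>" and W: "fam_summable W" and V: "fam_summable V"
  shows "(a \<bullet> v + fam_inner W V)\<^sup>2
    \<le> (2 * (norm a)\<^sup>2 + 2 / \<theta> * fam_inner W W) * (1/2 * (v \<bullet> v + \<theta> * fam_inner V V))"
proof (rule discriminant_nonpos)
  show "0 \<le> 1/2 * (v \<bullet> v + \<theta> * fam_inner V V)" using \<theta> fam_inner_nonneg[of V] by simp
  fix t :: real
  \<comment> \<open>After multiplication by \<open>2 / \<theta>\<close> the mixed term becomes
    \<open>2 * t * fam_inner W V\<close>, matching the one of the vector part.\<close>
  let ?r = "t * \<theta> / 2"
  have "0 \<le> 1/2 * ((2 *\<^sub>R a - t *\<^sub>R v) \<bullet> (2 *\<^sub>R a - t *\<^sub>R v))" by simp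
  moreover have "0 \<le> 2 / \<theta> * (fam_inner W W - 2 * ?r * fam_inner W V + ?r\<^sup>2 * fam_inner V V)"
    using fam_inner_diff_nonneg[OF W V, of ?r] by (rule mult_nonneg_nonneg[rotated]) (use \<theta> in simp)
  ultimately have "0 \<le> 1/2 * ((2 *\<^sub>R a - t *\<^sub>R v) \<bullet> (2 *\<^sub>R a - t *\<^sub>R v))
    + 2 / \<theta> * (fam_inner W W - 2 * ?r * fam_inner W V + ?r\<^sup>2 * fam_inner V V)"
    by (rule add_nonneg_nonneg)
  also have "\<dots> = 2 * (norm a)\<^sup>2 + 2 / \<theta> * fam_inner W W - 2 * t * (a \<bullet> v + fam_inner W V)
    + t\<^sup>2 * (1/2 * (v \<bullet> v + \<theta> * fam_inner V V))"
    unfolding power2_norm_eq_inner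
    using \<theta> by (simp add: inner_diff_left inner_diff_right inner_commute[of v a]
        power2_eq_square field_simps)
  finally show "0 \<le> 2 * (norm a)\<^sup>2 + 2 / \<theta> * fam_inner W W - 2 * t * (a \<bullet> v + fam_inner W V)
    + t\<^sup>2 * (1/2 * (v \<bullet> v + \<theta> * fam_inner V V))" .
qed

text \<open>Unordered summability permits enumerating the pairs by \<open>prod_decode\<close>, which
  leaves an ordinary series of measurable functions.\<close>

lemma borel_measurable_infsum_nat_prod:
  fixes F :: "nat \<times> nat \<Rightarrow> 'a \<Rightarrow> real"
  assumes F: "\<And>z. F z \<in> borel_measurable M"
    and sum: "\<And>x. x \<in> space M \<Longrightarrow> (\<lambda>z. F z x) summable_on UNIV"
  shows "(\<lambda>x. \<Sum>\<^sub>\<infinity>z. F z x) \<in> borel_measurable M"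
proof -
  have "(\<Sum>\<^sub>\<infinity>z. F z x) = (\<Sum>n. F (prod_decode n) x)" if "x \<in> space M" for x
  proof -
    have "((\<lambda>z. F z x) has_sum (\<Sum>\<^sub>\<infinity>z. F z x)) UNIV" using sum[OF that] by simp
    then have "((\<lambda>n. F (prod_decode n) x) has_sum (\<Sum>\<^sub>\<infinity>z. F z x)) UNIV"
      by (subst has_sum_reindex_bij_betw[OF bij_prod_decode])
    then show ?thesis by (intro sums_unique has_sum_imp_sums)
  qed
  then have "(\<lambda>x. \<Sum>\<^sub>\<infinity>z. F z x) \<in> borel_measurable M
    \<longleftrightarrow> (\<lambda>x. \<Sum>n. F (prod_decode n) x) \<in> borel_measurable M"
    by (intro measurable_cong)
  then show ?thesis using borel_measurable_suminf[of "\<lambda>n. F (prod_decode n)" M] F by simp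
qed

lemma borel_measurable_tr_AtB:
  fixes W V :: "'a \<Rightarrow> ('n::finite) kmat"
  assumes "\<And>J K. (\<lambda>x. W x J K) \<in> borel_measurable M" "\<And>J K. (\<lambda>x. V x J K) \<in> borel_measurable M"
  shows "(\<lambda>x. tr_AtB p (W x) (V x)) \<in> borel_measurable M"
  unfolding tr_AtB_def using assms by (intro borel_measurable_sum borel_measurable_times)

lemma borel_measurable_kron_pow:
  fixes F :: "'a \<Rightarrow> real^'n^'n"
  assumes "F \<in> borel_measurable M"
  shows "(\<lambda>x. kron_pow (F x) p J K) \<in> borel_measurable M"
  using assms unfolding kron_pow_def borel_measurable_matrix_iff
  by (cases "length J = p \<and> length K = p") (auto intro!: borel_measurable_prod)

lemma borel_measurable_fam_inner:
  fixes W V :: "'a \<Rightarrow> nat \<times> nat \<Rightarrow> ('n::finite) kmat"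
  assumes "\<And>z J K. (\<lambda>x. W x z J K) \<in> borel_measurable M" "\<And>z J K. (\<lambda>x. V x z J K) \<in> borel_measurable M"
    and "\<And>x. x \<in> space M \<Longrightarrow> fam_summable (W x)" "\<And>x. x \<in> space M \<Longrightarrow> fam_summable (V x)"
  shows "(\<lambda>x. fam_inner (W x) (V x)) \<in> borel_measurable M"
  unfolding fam_inner_def
  by (intro borel_measurable_infsum_nat_prod borel_measurable_tr_AtB assms
      has_sum_imp_summable[OF fam_inner_has_sum])

section \<open>The readout operator\<close>

text \<open>Bilinearity and the reproducing property express the norm through values of
  \<open>k\<close> alone; here the abstract \<open>ip\<close> becomes computable.\<close>

lemma rkhs_kernel_combination:
  fixes \<alpha> :: "'s \<Rightarrow> real"
  assumes rkhs: "is_rkhs X k H ip" and J: "finite J" "J \<subseteq> X"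
  defines "g \<equiv> (\<lambda>y. \<Sum>q\<in>J. \<alpha> q * kernel_section X k q y)"
  shows "g \<in> H" and "ip g g = (\<Sum>q\<in>J. \<Sum>r\<in>J. \<alpha> q * \<alpha> r * k q r)"
proof -
  interpret semi_inner_function_space H ip using rkhs by (rule is_rkhs_semi_inner)
  have KH: "kernel_section X k q \<in> H" if "q \<in> X" for q
    using rkhs that unfolding is_rkhs_def by blast
  have zH: "(\<lambda>y. 0) \<in> H" using rkhs unfolding is_rkhs_def by blast
  have comb: "(\<lambda>y. \<Sum>q\<in>J. \<alpha> q * kernel_section X k q y) \<in> H
    \<and> (\<forall>g'\<in>H. ip (\<lambda>y. \<Sum>q\<in>J. \<alpha> q * kernel_section X k q y) g'
          = (\<Sum>q\<in>J. \<alpha> q * ip (kernel_section X k q) g'))"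
    using J
  proof (induction J)
    case empty
    have "ip (\<lambda>y. 0) g' = 0" if "g' \<in> H" for g' using ip_comb_left[OF zH zH that, of 0 0] by simp
    then show ?case using zH by simp
  next
    case (insert q J)
    let ?s = "\<lambda>y. \<Sum>q\<in>J. \<alpha> q * kernel_section X k q y"
    have s: "?s \<in> H" and K: "kernel_section X k q \<in> H" using insert KH by auto
    have eq: "(\<lambda>y. \<Sum>q\<in>insert q J. \<alpha> q * kernel_section X k q y)
      = (\<lambda>y. \<alpha> q * kernel_section X k q y + 1 * ?s y)"
      using insert by simp
    show ?case
      unfolding eq
    proof (intro conjI ballI comb_closed K s)
      fix g' assume g': "g' \<in> H"
      have "ip ?s g' = (\<Sum>q\<in>J. \<alpha> q * ip (kernel_section X k q) g')" using insert g' by blast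
      then show "ip (\<lambda>y. \<alpha> q * kernel_section X k q y + 1 * ?s y) g'
        = (\<Sum>q\<in>insert q J. \<alpha> q * ip (kernel_section X k q) g')"
        using insert.hyps by (subst ip_comb_left[OF K s g']) simp
    qed
  qed
  then show gH: "g \<in> H" by (simp add: g_def)
  have "ip (kernel_section X k q) g = g q" if "q \<in> J" for q
  proof -
    have q: "q \<in> X" using that J by blast
    have "ip (kernel_section X k q) g = ip g (kernel_section X k q)"
      using KH[OF q] gH by (rule ip_commute)
    also have "\<dots> = g q" using rkhs gH q unfolding is_rkhs_def by blast
    finally show ?thesis .
  qed
  then have "ip g g = (\<Sum>q\<in>J. \<alpha> q * g q)"
    using comb gH by (simp add: g_def[symmetric])
  also have "\<dots> = (\<Sum>q\<in>J. \<Sum>r\<in>J. \<alpha> q * \<alpha> r * k q r)"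
    unfolding g_def sum_distrib_left
    by (intro sum.cong refl) (use J in \<open>auto simp: kernel_section_def\<close>)
  finally show "ip g g = (\<Sum>q\<in>J. \<Sum>r\<in>J. \<alpha> q * \<alpha> r * k q r)" .
qed

lemma in_L2_iff:
  assumes "\<Omega> \<in> sets lebesgue"
  shows "in_L2 \<Omega> v \<longleftrightarrow> v \<in> L2_functions (lebesgue_on \<Omega>)"
  using assms by (simp add: in_L2_def L2_functions_def set_integrable_def integrable_restrict_space)

lemma L2_norm_eq:
  assumes "\<Omega> \<in> sets lebesgue"
  shows "L2_norm \<Omega> v = sqrt (\<integral>x. (v x)\<^sup>2 \<partial>lebesgue_on \<Omega>)"
  using assms by (simp add: L2_norm_def set_lebesgue_integral_def integral_restrict_space)

lemma ae_eq_on_iff: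
  assumes "\<Omega> \<in> sets lebesgue"
  shows "ae_eq_on \<Omega> v w \<longleftrightarrow> (AE x in lebesgue_on \<Omega>. v x = w x)"
  using assms by (simp add: ae_eq_on_def AE_restrict_space_iff)

text \<open>Needed for uniqueness. Linearity is available almost everywhere and for two summands, so
  induction on \<open>J\<close> collects the finitely many exceptional null sets.\<close>

lemma bounded_linear_to_L2_kernel_combination:
  assumes R: "bounded_linear_to_L2 H ip \<Omega> R" and \<Omega>: "\<Omega> \<in> sets lebesgue"
    and rkhs: "is_rkhs X k H ip"
    and P: "\<And>q. q \<in> X \<Longrightarrow> ae_eq_on \<Omega> (R (kernel_section X k q)) (P q)"
    and J: "finite J" "J \<subseteq> X"
  shows "AE x in lebesgue_on \<Omega>.
    R (\<lambda>y. \<Sum>q\<in>J. \<alpha> q * kernel_section X k q y) x = (\<Sum>q\<in>J. \<alpha> q * P q x)"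
proof -
  have lin: "ae_eq_on \<Omega> (R (\<lambda>y. a * g y + b * g' y)) (\<lambda>x. a * R g x + b * R g' x)"
    if "g \<in> H" "g' \<in> H" for g g' a b
    using R that unfolding bounded_linear_to_L2_def by blast
  show ?thesis
    using J
  proof (induction J)
    case empty
    have "(\<lambda>y. 0) \<in> H" using rkhs unfolding is_rkhs_def by blast
    \<comment> \<open>Coefficients 0 and 0 give the value 0 at the zero function, almost
      everywhere.\<close>
    from lin[OF this this, of 0 0] show ?case by (simp add: ae_eq_on_iff[OF \<Omega>])
  next
    case (insert q J)
    let ?K = "kernel_section X k q" and ?s = "\<lambda>y. \<Sum>q\<in>J. \<alpha> q * kernel_section X k q y"
    have q: "q \<in> X" using insert.prems by simp
    have K: "?K \<in> H" using rkhs q unfolding is_rkhs_def by blast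
    have s: "?s \<in> H"
      by (rule rkhs_kernel_combination(1)[OF rkhs]) (use insert in auto)
    have "AE x in lebesgue_on \<Omega>. R (\<lambda>y. \<alpha> q * ?K y + 1 * ?s y) x = \<alpha> q * R ?K x + 1 * R ?s x"
      using lin[OF K s, of "\<alpha> q" 1] by (simp only: ae_eq_on_iff[OF \<Omega>])
    moreover have "AE x in lebesgue_on \<Omega>. R ?K x = P q x"
      using P[OF q] by (simp add: ae_eq_on_iff[OF \<Omega>])
    moreover have "AE x in lebesgue_on \<Omega>. R ?s x = (\<Sum>q\<in>J. \<alpha> q * P q x)"
      using insert by simp
    ultimately show ?case
      by eventually_elim (use insert.hyps in simp)
  qed
qed

theorem theorem3:
  fixes \<Omega> :: "(real^'n) set"
    and \<beta> Re Wi \<theta> c0 :: real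
    and D :: "(real^'n^'n) set"
    and s :: "real^'n^'n \<Rightarrow> real^'n^'n"
    and h :: "real^'n^'n \<Rightarrow> real"
    and f :: "nat \<Rightarrow> real \<Rightarrow> real"
    and c :: "nat \<Rightarrow> nat \<Rightarrow> real"
    and kt :: "real^'n^'n \<Rightarrow> real^'n^'n \<Rightarrow> real"
    and k :: "'n state \<Rightarrow> 'n state \<Rightarrow> real"
    and H :: "('n state \<Rightarrow> real) set"
    and ip :: "('n state \<Rightarrow> real) \<Rightarrow> ('n state \<Rightarrow> real) \<Rightarrow> real"
    and a0 :: "real^'n"
    and Am :: "nat \<Rightarrow> nat \<Rightarrow> 'n kmat"
    and A :: real
    and \<psi> :: "real^'n \<Rightarrow> real^'n^'n \<Rightarrow> real"
  assumes \<Omega>_meas: "\<Omega> \<in> sets lebesgue"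
    and \<beta>: "0 < \<beta>" "\<beta> < 1"
    and Re: "0 < Re" and Wi: "0 < Wi"
    and \<theta>_def: "\<theta> = (1 - \<beta>) / (Re * Wi)"
    and D_psd: "\<forall>C\<in>D. psd_mat C"
    and s_sym: "\<forall>C\<in>D. sym_mat (s C)"
    and c0: "0 \<le> c0"
    and h_def: "\<forall>C. h C = - Wi * trace (s C) + c0"
    and f_meas: "\<forall>i. f i \<in> borel_measurable (restrict_space borel (set_spectrum D))"
    and c_nonneg: "\<forall>i p. 0 \<le> c i p"
    and h_series: "\<forall>C\<in>D. ((\<lambda>(i, p). c i p * (trace (mat_fun (f i) C ** mat_fun (f i) C)) ^ p)
                          has_sum h C) UNIV"
    and kt_def: "\<forall>C1 C2. kt C1 C2 =
                   (\<Sum>\<^sub>\<infinity>(i, p)\<in>UNIV. c i p * (trace (mat_fun (f i) C1 ** mat_fun (f i) C2)) ^ p)"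
    and k_def: "\<forall>q1 q2. k q1 q2 = (1/2) * (LINT x:\<Omega>|lebesgue.
                   fst q1 x \<bullet> fst q2 x + \<theta> * kt (snd q1 x) (snd q2 x))"
    and H_rkhs: "is_rkhs (finite_energy_states \<Omega> D \<theta> h) k H ip"
    and A_summable: "(\<lambda>(i, p). frob_sq p (Am i p)) summable_on UNIV"
    and A_def: "A = sqrt (2 * (norm a0)\<^sup>2 + (2 / \<theta>) * (\<Sum>\<^sub>\<infinity>(i, p)\<in>UNIV. frob_sq p (Am i p)))"
    and \<psi>_def: "\<forall>u C. \<psi> u C = a0 \<bullet> u +
                   (\<Sum>\<^sub>\<infinity>(i, p)\<in>UNIV. sqrt (c i p) * tr_AtB p (Am i p) (kron_pow (mat_fun (f i) C) p))"
  shows "\<exists>R. bounded_linear_to_L2 H ip \<Omega> R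
            \<and> (\<forall>q\<in>finite_energy_states \<Omega> D \<theta> h.
                 ae_eq_on \<Omega> (R (kernel_section (finite_energy_states \<Omega> D \<theta> h) k q))
                           (\<lambda>x. \<psi> (fst q x) (snd q x)))
            \<and> (\<forall>R'. bounded_linear_to_L2 H ip \<Omega> R'
                    \<and> (\<forall>q\<in>finite_energy_states \<Omega> D \<theta> h.
                         ae_eq_on \<Omega> (R' (kernel_section (finite_energy_states \<Omega> D \<theta> h) k q))
                                   (\<lambda>x. \<psi> (fst q x) (snd q x)))
                    \<longrightarrow> (\<forall>g\<in>H. ae_eq_on \<Omega> (R' g) (R g)))
            \<and> op_norm_L2 H ip \<Omega> R \<le> A"
proof -
  define X where "X = finite_energy_states \<Omega> D \<theta> h"
  define M where "M = lebesgue_on \<Omega>"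
  define W where "W z = Am (fst z) (snd z)" for z
  \<comment> \<open>The square root splits the coefficient evenly between the two arguments of the
    kernel.\<close>
  define T where "T C z = (\<lambda>J K. sqrt (c (fst z) (snd z))
    * kron_pow (mat_fun (f (fst z)) C) (snd z) J K)" for C :: "real^'n^'n" and z
  define \<kappa> where "\<kappa> q r x = fst q x \<bullet> fst r x + \<theta> * kt (snd q x) (snd r x)"
    for q r :: "'n state" and x
  define P where "P q x = \<psi> (fst q x) (snd q x)" for q :: "'n state" and x
  have spM: "space M = \<Omega>" by (simp add: M_def)
  have \<theta>_pos: "0 < \<theta>" using \<beta> Re Wi by (simp add: \<theta>_def)
  have D_sym: "sym_mat C" if "C \<in> D" for C using D_psd that by (auto simp: psd_mat_def)

  have T_inner: "tr_AtB (snd z) (T C z) (T C' z)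
    = (\<lambda>(i, p). c i p * (trace (mat_fun (f i) C ** mat_fun (f i) C')) ^ p) z"
    if "C' \<in> D" for C C' z
    using c_nonneg unfolding T_def tr_AtB_cmult
    by (simp add: tr_AtB_commute[of _ "\<lambda>J K. _ * _ J K"] tr_AtB_cmult tr_AtB_kron_pow
        trace_mult_symmetric[OF transpose_mat_fun[OF D_sym[OF that]]] inner_commute case_prod_unfold)
  \<comment> \<open>Term by term, the series for \<open>h\<close> is the squared norm of
    \<open>T C\<close>, so its convergence makes the feature vectors over \<open>D\<close> square
    summable.\<close>
  have T_sum: "fam_summable (T C)" and h_eq: "fam_inner (T C) (T C) = h C" if "C \<in> D" for C
    using h_series[rule_format, OF that]
    unfolding fam_summable_def fam_inner_def frob_sq_eq_tr_AtB T_inner[OF that] has_sum_iff by simp_all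
  have kt_eq: "kt C C' = fam_inner (T C) (T C')" if "C' \<in> D" for C C'
    unfolding fam_inner_def T_inner[OF that] kt_def[rule_format] ..
  have W_sum: "fam_summable W"
    using A_summable by (simp add: fam_summable_def W_def case_prod_unfold)
  have \<psi>_eq: "\<psi> u C = a0 \<bullet> u + fam_inner W (T C)" for u C
    unfolding \<psi>_def[rule_format] fam_inner_def T_def W_def tr_AtB_cmult
    by (simp add: case_prod_unfold)
  have A_eq: "A = sqrt (2 * (norm a0)\<^sup>2 + 2 / \<theta> * fam_inner W W)"
    unfolding A_def fam_inner_self W_def by (simp add: case_prod_unfold)
  have A2_nonneg: "0 \<le> 2 * (norm a0)\<^sup>2 + 2 / \<theta> * fam_inner W W"
    using \<theta>_pos fam_inner_nonneg[of W] by simp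
  have A_nonneg: "0 \<le> A" and A2: "A\<^sup>2 = 2 * (norm a0)\<^sup>2 + 2 / \<theta> * fam_inner W W"
    using A2_nonneg by (simp_all add: A_eq)

  \<comment> \<open>Measurability and integrability of the kernel densities\<close>
  have state: "fst q \<in> borel_measurable M" "snd q \<in> borel_measurable M"
      "\<And>x. x \<in> \<Omega> \<Longrightarrow> snd q x \<in> D"
      "(\<integral>\<^sup>+x. ennreal ((1/2) * ((norm (fst q x))\<^sup>2 + \<theta> * h (snd q x))) \<partial>M) < \<infinity>"
    if "q \<in> X" for q
    using that \<Omega>_meas
    by (auto simp: X_def M_def finite_energy_states_def nn_integral_restrict_space)
  have T_meas: "(\<lambda>x. T (snd q x) z J K) \<in> borel_measurable M" if q: "q \<in> X" for q z J K
  proof -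
    have "(\<lambda>x. mat_fun (f (fst z)) (snd q x)) \<in> borel_measurable M"
      using state[OF q] D_sym f_meas by (intro mat_fun_measurable[of "snd q" M D]) (auto simp: spM)
    then show ?thesis
      unfolding T_def by (intro borel_measurable_times borel_measurable_const borel_measurable_kron_pow)
  qed
  have P_meas: "P q \<in> borel_measurable M" if q: "q \<in> X" for q
  proof -
    have "(\<lambda>x. fam_inner W (T (snd q x))) \<in> borel_measurable M"
      using state[OF q] by (intro borel_measurable_fam_inner T_meas q W_sum T_sum) (auto simp: spM)
    then show ?thesis
      unfolding P_def \<psi>_eq using state(1)[OF q] by (intro borel_measurable_add borel_measurable_inner) auto
  qed
  have \<kappa>_eq: "\<kappa> q r x = fst q x \<bullet> fst r x + \<theta> * fam_inner (T (snd q x)) (T (snd r x))"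
    if "r \<in> X" "x \<in> \<Omega>" for q r x
    unfolding \<kappa>_def using kt_eq[OF state(3)[OF that]] by simp
  have \<kappa>_meas: "\<kappa> q r \<in> borel_measurable M" if q: "q \<in> X" and r: "r \<in> X" for q r
  proof -
    have "(\<lambda>x. fst q x \<bullet> fst r x + \<theta> * fam_inner (T (snd q x)) (T (snd r x))) \<in> borel_measurable M"
      using state[OF q] state[OF r]
      by (intro borel_measurable_add borel_measurable_inner borel_measurable_times
          borel_measurable_const borel_measurable_fam_inner T_meas q r T_sum) (auto simp: spM)
    then show ?thesis by (subst measurable_cong) (auto simp: spM \<kappa>_eq[OF r])
  qed
  \<comment> \<open>Half the integral of \<open>\<kappa> q q\<close> is the energy of
    \<open>q\<close>, and this density is nonnegative on \<Omega>, so finite energy amounts to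
    integrability.\<close>
  have \<kappa>_diag: "integrable M (\<kappa> q q)" if q: "q \<in> X" for q
  proof -
    have diag: "\<kappa> q q x = (norm (fst q x))\<^sup>2 + \<theta> * h (snd q x)" and nonneg: "0 \<le> \<kappa> q q x" if "x \<in> space M" for x
      using that state(3)[OF q, of x] \<theta>_pos fam_inner_nonneg[of "T (snd q x)"]
      by (simp_all add: spM \<kappa>_eq[OF q] h_eq[symmetric] power2_norm_eq_inner)
    have "(\<integral>\<^sup>+x. ennreal ((1/2) * \<kappa> q q x) \<partial>M)
      = (\<integral>\<^sup>+x. ennreal ((1/2) * ((norm (fst q x))\<^sup>2 + \<theta> * h (snd q x))) \<partial>M)"
      by (intro nn_integral_cong) (simp add: diag)
    also have "\<dots> < \<infinity>" by (rule state(4)[OF q])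
    finally have "integrable M (\<lambda>x. (1/2) * \<kappa> q q x)"
      using \<kappa>_meas[OF q q] nonneg by (intro integrableI_nonneg) auto
    from integrable_mult_right[OF this, of 2] show ?thesis by simp
  qed
  \<comment> \<open>Off the diagonal, the density is dominated by the mean of the two diagonal
    ones.\<close>
  have \<kappa>_int: "integrable M (\<kappa> q r)" if q: "q \<in> X" and r: "r \<in> X" for q r
  proof (rule Bochner_Integration.integrable_bound)
    show "integrable M (\<lambda>x. (\<kappa> q q x + \<kappa> r r x) / 2)"
      using \<kappa>_diag[OF q] \<kappa>_diag[OF r] by simp
    show "AE x in M. norm (\<kappa> q r x) \<le> norm ((\<kappa> q q x + \<kappa> r r x) / 2)"
    proof (rule AE_I2)
      fix x assume "x \<in> space M"
      then have x: "x \<in> \<Omega>" by (simp add: spM)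
      let ?u = "fst q x" and ?v = "fst r x" and ?S = "T (snd q x)" and ?S' = "T (snd r x)"
      have "2 * \<bar>?u \<bullet> ?v\<bar> \<le> 2 * (norm ?u * norm ?v)" using Cauchy_Schwarz_ineq2[of ?u ?v] by simp
      also have "\<dots> \<le> ?u \<bullet> ?u + ?v \<bullet> ?v"
        using sum_squares_bound[of "norm ?u" "norm ?v"] by (simp add: power2_norm_eq_inner)
      finally have "2 * \<bar>?u \<bullet> ?v\<bar> \<le> ?u \<bullet> ?u + ?v \<bullet> ?v" .
      moreover have "\<theta> * \<bar>fam_inner ?S ?S'\<bar> \<le> \<theta> * ((fam_inner ?S ?S + fam_inner ?S' ?S') / 2)"
        using \<theta>_pos abs_fam_inner_le[OF T_sum[OF state(3)[OF q x]] T_sum[OF state(3)[OF r x]]]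
        by (intro mult_left_mono) auto
      moreover have "\<bar>\<kappa> q r x\<bar> \<le> \<bar>?u \<bullet> ?v\<bar> + \<theta> * \<bar>fam_inner ?S ?S'\<bar>"
        unfolding \<kappa>_eq[OF r x] using \<theta>_pos abs_triangle_ineq[of "?u \<bullet> ?v" "\<theta> * fam_inner ?S ?S'"]
        by (simp add: abs_mult)
      ultimately have "\<bar>\<kappa> q r x\<bar> \<le> (\<kappa> q q x + \<kappa> r r x) / 2"
        unfolding \<kappa>_eq[OF q x] \<kappa>_eq[OF r x] by (simp add: distrib_left)
      then show "norm (\<kappa> q r x) \<le> norm ((\<kappa> q q x + \<kappa> r r x) / 2)" by simp
    qed
  qed (rule \<kappa>_meas[OF q r])
  have k_eq: "k q r = (1/2) * (\<integral>x. \<kappa> q r x \<partial>M)" for q r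
    unfolding k_def[rule_format] \<kappa>_def M_def set_lebesgue_integral_def
    using \<Omega>_meas by (simp add: integral_restrict_space)

  \<comment> \<open>By linearity the combined output pairs the fixed data with a single velocity
    \<open>?v\<close> and a single family \<open>?U\<close>. One use of the weighted inequality then
    yields the Gram form of \<kappa> at \<open>x\<close>.\<close>
  have pointwise: "(\<Sum>q\<in>J. \<alpha> q * P q x)\<^sup>2
      \<le> A\<^sup>2 * (1/2 * (\<Sum>q\<in>J. \<Sum>r\<in>J. \<alpha> q * \<alpha> r * \<kappa> q r x))"
    if J: "finite J" "J \<subseteq> X" and x: "x \<in> \<Omega>" for J \<alpha> x
  proof -
    let ?v = "\<Sum>q\<in>J. \<alpha> q *\<^sub>R fst q x"
    let ?U = "\<lambda>z I K. \<Sum>q\<in>J. \<alpha> q * T (snd q x) z I K"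
    have T_sum': "fam_summable (T (snd q x))" if "q \<in> J" for q
      using that J state(3) x by (intro T_sum) blast
    have U: "fam_summable ?U"
      "fam_inner ?U ?U = (\<Sum>q\<in>J. \<Sum>r\<in>J. \<alpha> q * \<alpha> r * fam_inner (T (snd q x)) (T (snd r x)))"
      "fam_inner W ?U = (\<Sum>q\<in>J. \<alpha> q * fam_inner W (T (snd q x)))"
      by (rule fam_comb[OF J(1)]; fact T_sum' W_sum)+
    have "(\<Sum>q\<in>J. \<alpha> q * P q x) = a0 \<bullet> ?v + fam_inner W ?U"
      unfolding U(3) P_def \<psi>_eq
      by (simp add: inner_sum_right distrib_left sum.distrib)
    moreover have "?v \<bullet> ?v = (\<Sum>q\<in>J. \<Sum>r\<in>J. \<alpha> q * \<alpha> r * (fst q x \<bullet> fst r x))"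
      unfolding inner_sum_left inner_sum_right by (simp add: mult_ac sum_distrib_left inner_commute)
    moreover have "(\<Sum>q\<in>J. \<Sum>r\<in>J. \<alpha> q * \<alpha> r * \<kappa> q r x) = (\<Sum>q\<in>J. \<Sum>r\<in>J. \<alpha> q * \<alpha> r
      * (fst q x \<bullet> fst r x + \<theta> * fam_inner (T (snd q x)) (T (snd r x))))"
      using J(2) by (intro sum.cong refl) (simp add: \<kappa>_eq[OF _ x] subsetD)
    then have "(\<Sum>q\<in>J. \<Sum>r\<in>J. \<alpha> q * \<alpha> r * \<kappa> q r x)
      = (\<Sum>q\<in>J. \<Sum>r\<in>J. \<alpha> q * \<alpha> r * (fst q x \<bullet> fst r x)) + \<theta> * fam_inner ?U ?U"
      unfolding U(2) by (simp add: distrib_left sum.distrib sum_distrib_left mult_ac)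
    ultimately show ?thesis
      using weighted_Cauchy_Schwarz[OF \<theta>_pos W_sum U(1), of a0 ?v] unfolding A2 by simp
  qed

  \<comment> \<open>The graph over the span of the kernel sections\<close>
  define K where "K = kernel_section X k"
  define comb_K where "comb_K J \<alpha> = (\<lambda>y. \<Sum>q\<in>J. \<alpha> q * K q y)" for J :: "'n state set" and \<alpha>
  define comb_P where "comb_P J \<alpha> = (\<lambda>x. \<Sum>q\<in>J. \<alpha> q * P q x)" for J :: "'n state set" and \<alpha>
  define Gr where "Gr = (\<lambda>(J, \<alpha>). (comb_K J \<alpha>, comb_P J \<alpha>)) ` ({J. finite J \<and> J \<subseteq> X} \<times> UNIV)"
  have GrI: "(comb_K J \<alpha>, comb_P J \<alpha>) \<in> Gr" if "finite J" "J \<subseteq> X" for J \<alpha>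
    unfolding Gr_def by (rule image_eqI[of _ _ "(J, \<alpha>)"]) (use that in simp_all)
  have GrE: "\<exists>J \<alpha>. finite J \<and> J \<subseteq> X \<and> s = comb_K J \<alpha> \<and> w = comb_P J \<alpha>" if "(s, w) \<in> Gr" for s w
    using that by (force simp only: Gr_def)
  have rkhs: "is_rkhs X k H ip" using H_rkhs by (simp add: X_def)
  have comb_K_H: "comb_K J \<alpha> \<in> H"
    and ip_comb_K: "ip (comb_K J \<alpha>) (comb_K J \<alpha>) = (\<Sum>q\<in>J. \<Sum>r\<in>J. \<alpha> q * \<alpha> r * k q r)"
    if "finite J" "J \<subseteq> X" for J \<alpha>
    using rkhs_kernel_combination[OF rkhs that, of \<alpha>] by (simp_all only: comb_K_def K_def)
  \<comment> \<open>Integration turns the Gram form of \<kappa> into that of \<open>k\<close>, the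
    squared norm in \<open>H\<close>; one estimate gives both square integrability and the
    bound.\<close>
  have comb_P_L2: "comb_P J \<alpha> \<in> L2_functions M"
    and comb_P_le: "(\<integral>x. (comb_P J \<alpha> x)\<^sup>2 \<partial>M) \<le> A\<^sup>2 * ip (comb_K J \<alpha>) (comb_K J \<alpha>)"
    if J: "finite J" "J \<subseteq> X" for J \<alpha>
  proof -
    let ?B = "\<lambda>x. A\<^sup>2 * (1/2 * (\<Sum>q\<in>J. \<Sum>r\<in>J. \<alpha> q * \<alpha> r * \<kappa> q r x))"
    have \<kappa>J: "integrable M (\<kappa> q r)" if "q \<in> J" "r \<in> J" for q r using that J \<kappa>_int by blast
    have B: "integrable M ?B"
      using \<kappa>J by (intro integrable_mult_right integrable_sum) auto
    have meas: "comb_P J \<alpha> \<in> borel_measurable M"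
      unfolding comb_P_def using J P_meas by (intro borel_measurable_sum borel_measurable_times) auto
    have le: "(comb_P J \<alpha> x)\<^sup>2 \<le> ?B x" if "x \<in> space M" for x
      using pointwise[OF J] that by (simp add: comb_P_def spM)
    have int: "integrable M (\<lambda>x. (comb_P J \<alpha> x)\<^sup>2)"
    proof (rule Bochner_Integration.integrable_bound[OF B])
      show "AE x in M. norm ((comb_P J \<alpha> x)\<^sup>2) \<le> norm (?B x)"
      proof (rule AE_I2)
        fix x assume "x \<in> space M"
        then show "norm ((comb_P J \<alpha> x)\<^sup>2) \<le> norm (?B x)"
          using order_trans[OF le abs_ge_self] by (simp only: real_norm_def abs_power2)
      qed
    qed (use meas in simp)
    with meas show "comb_P J \<alpha> \<in> L2_functions M" by (simp add: L2_functions_def)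
    have "(\<integral>x. (comb_P J \<alpha> x)\<^sup>2 \<partial>M) \<le> (\<integral>x. ?B x \<partial>M)"
      using int B le by (rule integral_mono)
    also have "(\<integral>x. ?B x \<partial>M) = A\<^sup>2 * (1/2 * (\<Sum>q\<in>J. \<Sum>r\<in>J. \<alpha> q * \<alpha> r * (\<integral>x. \<kappa> q r x \<partial>M)))"
      using \<kappa>J by (simp add: Bochner_Integration.integral_sum integrable_sum)
    also have "\<dots> = A\<^sup>2 * ip (comb_K J \<alpha>) (comb_K J \<alpha>)"
      unfolding ip_comb_K[OF J] k_eq by (simp add: sum_distrib_left mult_ac)
    finally show "(\<integral>x. (comb_P J \<alpha> x)\<^sup>2 \<partial>M) \<le> A\<^sup>2 * ip (comb_K J \<alpha>) (comb_K J \<alpha>)" .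
  qed

  have Gr_comb: "((\<lambda>y. a * s y + b * s' y), (\<lambda>x. a * w x + b * w' x)) \<in> Gr"
    if sw: "(s, w) \<in> Gr" and sw': "(s', w') \<in> Gr" for s w s' w' a b
  proof -
    obtain J \<alpha> where J1: "finite J" "J \<subseteq> X" and eq1: "s = comb_K J \<alpha>" "w = comb_P J \<alpha>"
      using GrE[OF sw] by blast
    obtain J' \<alpha>' where J2: "finite J'" "J' \<subseteq> X" and eq2: "s' = comb_K J' \<alpha>'" "w' = comb_P J' \<alpha>'"
      using GrE[OF sw'] by blast
    \<comment> \<open>Combinations over different index sets are merged over the union, each
      coefficient function being extended by 0.\<close>
    define \<gamma> where "\<gamma> q = a * (if q \<in> J then \<alpha> q else 0) + b * (if q \<in> J' then \<alpha>' q else 0)" for q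
    have \<gamma>: "(\<Sum>q\<in>J \<union> J'. \<gamma> q * t q) = a * (\<Sum>q\<in>J. \<alpha> q * t q) + b * (\<Sum>q\<in>J'. \<alpha>' q * t q)"
      for t :: "'n state \<Rightarrow> real"
    proof -
      have "(\<Sum>q\<in>J. \<alpha> q * t q) = (\<Sum>q\<in>J \<union> J'. (if q \<in> J then \<alpha> q else 0) * t q)"
        "(\<Sum>q\<in>J'. \<alpha>' q * t q) = (\<Sum>q\<in>J \<union> J'. (if q \<in> J' then \<alpha>' q else 0) * t q)"
        using J1 J2 by (intro sum.mono_neutral_cong_left; simp)+
      then show ?thesis
        by (simp add: \<gamma>_def sum_distrib_left sum.distrib[symmetric] distrib_right mult.assoc)
    qed
    have "(comb_K (J \<union> J') \<gamma>, comb_P (J \<union> J') \<gamma>) \<in> Gr"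
      using J1 J2 by (intro GrI) simp_all
    then show ?thesis unfolding eq1 eq2 comb_K_def comb_P_def \<gamma> .
  qed
  have Gr_single: "(K q, P q) \<in> Gr" if "q \<in> X" for q
  proof -
    have "(comb_K {q} (\<lambda>_. 1), comb_P {q} (\<lambda>_. 1)) \<in> Gr" using that by (intro GrI) simp_all
    then show ?thesis by (simp add: comb_K_def comb_P_def)
  qed
  have semi: "semi_inner_function_space H ip" using rkhs by (rule is_rkhs_semi_inner)
  interpret dense_bounded_graph H ip M Gr A
  proof (intro dense_bounded_graph.intro semi dense_bounded_graph_axioms.intro A_nonneg Gr_comb)
    fix s w assume "(s, w) \<in> Gr"
    then obtain J \<alpha> where J: "finite J" "J \<subseteq> X" and eq: "s = comb_K J \<alpha>" "w = comb_P J \<alpha>"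
      using GrE by blast
    show "s \<in> H" unfolding eq by (rule comb_K_H[OF J])
    show "w \<in> L2_functions M" unfolding eq by (rule comb_P_L2[OF J])
    show "sqrt (\<integral>x. (w x)\<^sup>2 \<partial>M) \<le> A * sqrt (ip s s)"
      using real_sqrt_le_mono[OF comb_P_le[OF J, of \<alpha>]] A_nonneg unfolding eq
      by (simp add: real_sqrt_mult)
  next
    fix g and e :: real assume g: "g \<in> H" and e: "0 < e"
    \<comment> \<open>The density lemma measures errors by squared norms, hence the tolerance
      \<open>e\<^sup>2\<close>.\<close>
    have "\<exists>s\<in>fst ` Gr. ip (\<lambda>y. g y - s y) (\<lambda>y. g y - s y) < e\<^sup>2"
    proof (rule rkhs_kernel_sections_dense[OF rkhs _ _ _ _ g])
      show "fst ` Gr \<subseteq> H"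
      proof (rule image_subsetI)
        fix z assume "z \<in> Gr"
        then have "(fst z, snd z) \<in> Gr" by simp
        from GrE[OF this] show "fst z \<in> H" using comb_K_H by (elim exE conjE) simp
      qed
      show "(\<lambda>y. a * s y + b * s' y) \<in> fst ` Gr" if "s \<in> fst ` Gr" "s' \<in> fst ` Gr" for s s' a b
      proof -
        obtain w w' where "(s, w) \<in> Gr" "(s', w') \<in> Gr" using \<open>s \<in> fst ` Gr\<close> \<open>s' \<in> fst ` Gr\<close> by auto
        from image_eqI[OF _ Gr_comb[OF this], of _ fst] show ?thesis by simp
      qed
      show "kernel_section X k q \<in> fst ` Gr" if "q \<in> X" for q
        using image_eqI[OF _ Gr_single[OF that], of _ fst] by (simp add: K_def)
      show "fst ` Gr \<noteq> {}" using GrI[of "{}"] by blast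
    qed (use e in simp)
    then show "\<exists>s w. (s, w) \<in> Gr \<and> sqrt (ip (\<lambda>y. g y - s y) (\<lambda>y. g y - s y)) < e"
      using e by (force intro: real_less_lsqrt)
  qed

  \<comment> \<open>Existence, uniqueness and norm of the operator\<close>
  note L2_simps = in_L2_iff[OF \<Omega>_meas, folded M_def] L2_norm_eq[OF \<Omega>_meas, folded M_def]
    ae_eq_on_iff[OF \<Omega>_meas, folded M_def]
  have bound: "\<forall>g\<in>H. L2_norm \<Omega> (extension g) \<le> A * rkhs_norm ip g"
    using extension_bound by (simp add: L2_simps rkhs_norm_def)
  have "bounded_linear_to_L2 H ip \<Omega> extension"
    unfolding bounded_linear_to_L2_def
    using bound extension_L2 extension_comb by (auto simp: L2_simps)
  moreover have "ae_eq_on \<Omega> (extension (K q)) (\<lambda>x. \<psi> (fst q x) (snd q x))" if "q \<in> X" for q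
    using extension_graph[OF Gr_single[OF that]] by (simp add: L2_simps P_def)
  \<comment> \<open>A competitor comes with a bound of its own. Agreement on kernel sections spreads
    to finite combinations, hence to \<open>Gr\<close>, and from there to \<open>H\<close> by
    density.\<close>
  moreover have "ae_eq_on \<Omega> (R' g) (extension g)"
    if R': "bounded_linear_to_L2 H ip \<Omega> R'"
      and R'K: "\<forall>q\<in>X. ae_eq_on \<Omega> (R' (K q)) (\<lambda>x. \<psi> (fst q x) (snd q x))" and g: "g \<in> H" for R' g
  proof -
    obtain B where B: "\<forall>g\<in>H. L2_norm \<Omega> (R' g) \<le> B * rkhs_norm ip g"
      using R' unfolding bounded_linear_to_L2_def by blast
    have R'Gr: "AE x in M. R' s x = w x" if sw: "(s, w) \<in> Gr" for s w
    proof -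
      obtain J \<alpha> where J: "finite J" "J \<subseteq> X" and eq: "s = comb_K J \<alpha>" "w = comb_P J \<alpha>"
        using GrE[OF sw] by blast
      show ?thesis
        unfolding eq comb_K_def comb_P_def K_def M_def
        by (rule bounded_linear_to_L2_kernel_combination[OF R' \<Omega>_meas rkhs _ J])
          (use R'K in \<open>simp add: P_def K_def\<close>)
    qed
    have "AE x in M. R' g x = extension g x"
    proof (rule extension_unique[OF _ _ _ R'Gr g])
      show "R' g \<in> L2_functions M" if "g \<in> H" for g
        using R' that unfolding bounded_linear_to_L2_def by (simp add: L2_simps)
      show "AE x in M. R' (\<lambda>y. a * g y + b * g' y) x = a * R' g x + b * R' g' x"
        if "g \<in> H" "g' \<in> H" for g g' a b
        using R' that unfolding bounded_linear_to_L2_def by (simp add: L2_simps)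
      show "sqrt (\<integral>x. (R' g x)\<^sup>2 \<partial>M) \<le> B * sqrt (ip g g)" if "g \<in> H" for g
        using B that by (simp add: L2_simps rkhs_norm_def)
    qed
    then show ?thesis by (simp add: L2_simps)
  qed
  \<comment> \<open>The number \<open>A\<close> is a member of the set whose infimum is the operator
    norm, and 0 is a lower bound of that set.\<close>
  moreover have "op_norm_L2 H ip \<Omega> extension \<le> A"
    unfolding op_norm_L2_def using A_nonneg bound by (intro cInf_lower) (auto intro!: bdd_belowI[of _ 0])
  ultimately show ?thesis
    unfolding X_def[symmetric] K_def[symmetric] by blast
qed

end
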